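(* Let $M$ be a regular matroid with ground set $E$ represented by a totally unimodular $r\times m$ matrix $A$ of rank $r$, let $\sigma,\sigma^*$ be acyclic signatures of the circuits and cocircuits of $M$, respectively, and let $w'\in V^*$ be a vector with $w'\cdot\sigma^*(\underline{C})>0$ for every cocircuit $\underline{C}$ of $M$. (1) Let $B$ be a basis of $M$. For all sufficiently small $\epsilon>0$ the image of $\widetilde{Z(B)}$ under the map $v\mapsto v+\epsilon w'$ contains a unique lattice point $\widetilde{z_B}$ of $\widetilde{Z_A}$ (the same point for all sufficiently small $\epsilon$), which corresponds to a unique $(\sigma,\sigma^* )$-compatible discrete orientation $\mathcal{O}'_B$ (i.e. there is a unique $(\sigma,\sigma^* )$-compatible orientation $\mathcal{O}'_B$ with $\psi(\mathcal{O}'_B)=A\,\widetilde{z_B}$). (2) The map $\phi$ which takes each basis $B$ to the orientation $\mathcal{O}'_B$ coincides with the map $\hat\beta$, where $\hat\beta(B)$ is the orientation with value $\sigma(C(B,e))(e)$ at each $e\notin B$ and value $\sigma^*(C^*(B,e))(e)$ at each $e\in B$; hence $\hat\beta$ gives a bijection between the set $B(M)$ of bases of $M$ and $\mathcal{X}(M;\sigma,\sigma^* )$.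
   Context: Totally unimodular means every square submatrix has determinant in $\{0,\pm1\}$. Columns of $A$ are denoted $A_e$, $e\in E$. A signed circuit of $M$ is a nonzero vector in $\ker(A)\cap\mathbb{Z}^E$ with all entries in $\{0,\pm1\}$ whose support is a circuit of $M$; a signed cocircuit is a nonzero vector in (row space of $A$) $\cap\,\mathbb{Z}^E$ with all entries in $\{0,\pm1\}$ whose support is a cocircuit. Each circuit (cocircuit) is the support of exactly two signed circuits (cocircuits), negatives of each other. A signature $\sigma$ of the circuits assigns to each circuit $\underline{C}$ a signed circuit $\sigma(\underline{C})$ with support $\underline{C}$; it is acyclic if the only nonnegative reals $a_{\underline{C}}$ with $\sum a_{\underline{C}}\sigma(\underline{C})=0$ are all zero. Analogously for signatures $\sigma^*$ of cocircuits. For a basis $B$: $C(B,e)$ ($e\notin B$) is the unique circuit in $B\cup\{e\}$, and $C^*(B,e)$ ($e\in B$) is the unique cocircuit in $(E\setminus B)\cup\{e\}$. A (discrete) orientation is a function $\mathcal{O}:E\to\{-1,1\}$. It is compatible with a signed (co)circuit $C$ if $\mathcal{O}(e)=C(e)$ for all $e$ in the support of $C$. It is $(\sigma,\sigma^* )$-compatible if every signed circuit compatible with it is of the form $\sigma(\underline{C})$ and every signed cocircuit compatible with it is of the form $\sigma^*(\underline{C})$; $\mathcal{X}(M;\sigma,\sigma^* )$ is the set of such orientations. Put $\psi(\mathcal{O})=\sum_{e:\,\mathcal{O}(e)=1}A_e\in\mathbb{R}^r$. $V^*\subseteq\mathbb{R}^E$ is the row space of $A$, $\pi_{V^*}$ is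 the orthogonal projection of $\mathbb{R}^E$ onto $V^*$, and $u_e$ is the standard basis vector of $\mathbb{R}^E$. The row zonotope is $\widetilde{Z_A}=\{\sum_{e\in E}c_e\pi_{V^*}(u_e):0\le c_e\le1\}$ and the column zonotope is $Z_A=\{\sum_{e\in E}c_eA_e:0\le c_e\le1\}$. The linear map $L:v\mapsto Av$ is an isomorphism $V^*\to\mathbb{R}^r$ taking $\widetilde{Z_A}$ onto $Z_A$. Lattice points of $V^*$ are the points of $L^{-1}(\mathbb{Z}^r)=\pi_{V^*}(\mathbb{Z}^E)$. For a basis $B$, $Z(B)=\sum_{e\in B}[0,A_e]+\sum_{e\notin B,\ \sigma(C(B,e))(e)=1}A_e\subseteq Z_A$ (Minkowski sum of segments, translated by a vector), and $\widetilde{Z(B)}=L^{-1}(Z(B))\subseteq\widetilde{Z_A}$. *)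

theory Defs
  imports "HOL-Analysis.Analysis"
begin

text \<open>
  A real \<open>r \<times> m\<close> matrix is an element of \<^typ>\<open>real ^ 'e ^ 'r\<close>; its columns are indexed by the
  ground set \<open>E\<close>, which is the whole finite type \<^typ>\<open>'e\<close>.
\<close>

section \<open>Totally unimodular matrices\<close>

text \<open>
  The injections \<open>f\<close> and \<open>g\<close> select and enumerate the rows and columns of a \<open>k \<times> k\<close> submatrix.
  The dimension of the library's \<^const>\<open>det\<close> is a type, so for this \<open>k\<close> the
  Leibniz sum is written out. A different enumeration of the same rows and columns
  only changes the sign.
\<close>
definition submatrix_det :: "real ^ 'e ^ 'r \<Rightarrow> nat \<Rightarrow> (nat \<Rightarrow> 'r) \<Rightarrow> (nat \<Rightarrow> 'e) \<Rightarrow> real" where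
  "submatrix_det A k f g =
     (\<Sum>p | p permutes {..<k}. of_int (sign p) * (\<Prod>i<k. A $ f i $ g (p i)))"

definition totally_unimodular :: "real ^ 'e ^ 'r \<Rightarrow> bool" where
  "totally_unimodular A \<longleftrightarrow>
     (\<forall>k f g. inj_on f {..<k} \<longrightarrow> inj_on g {..<k} \<longrightarrow> submatrix_det A k f g \<in> {-1, 0, 1})"


section \<open>The column matroid\<close>

definition bases_of :: "('e set \<Rightarrow> bool) \<Rightarrow> 'e set set" where
  "bases_of indep = {B. indep B \<and> (\<forall>I. indep I \<longrightarrow> B \<subseteq> I \<longrightarrow> I = B)}"

definition circuits_of :: "('e set \<Rightarrow> bool) \<Rightarrow> 'e set set" where
  "circuits_of indep = {C. \<not> indep C \<and> (\<forall>D. D \<subset> C \<longrightarrow> indep D)}"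

text \<open>The bases of the dual matroid are the complements of the bases.\<close>
definition dual_indep :: "('e set \<Rightarrow> bool) \<Rightarrow> 'e set \<Rightarrow> bool" where
  "dual_indep indep I \<longleftrightarrow> (\<exists>B \<in> bases_of indep. I \<subseteq> - B)"

text \<open>Injectivity makes two equal columns with different indices dependent.\<close>
definition col_indep :: "real ^ 'e ^ 'r \<Rightarrow> 'e set \<Rightarrow> bool" where
  "col_indep A I \<longleftrightarrow>
     inj_on (\<lambda>e. column e A) I \<and> independent ((\<lambda>e. column e A) ` I)"

definition bases :: "real ^ 'e ^ 'r \<Rightarrow> 'e set set" where
  "bases A = bases_of (col_indep A)"

definition circuits :: "real ^ 'e ^ 'r \<Rightarrow> 'e set set" where
  "circuits A = circuits_of (col_indep A)"

definition cocircuits :: "real ^ 'e ^ 'r \<Rightarrow> 'e set set" where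
  "cocircuits A = circuits_of (dual_indep (col_indep A))"

definition fund_circuit :: "real ^ 'e ^ 'r \<Rightarrow> 'e set \<Rightarrow> 'e \<Rightarrow> 'e set" where
  "fund_circuit A B e = (THE C. C \<in> circuits A \<and> C \<subseteq> insert e B)"

definition fund_cocircuit :: "real ^ 'e ^ 'r \<Rightarrow> 'e set \<Rightarrow> 'e \<Rightarrow> 'e set" where
  "fund_cocircuit A B e = (THE C. C \<in> cocircuits A \<and> C \<subseteq> insert e (- B))"


section \<open>Signed circuits, signed cocircuits and signatures\<close>

definition supp :: "real ^ 'e \<Rightarrow> 'e set" where
  "supp x = {e. x $ e \<noteq> 0}"

definition row_space :: "real ^ 'e ^ 'r \<Rightarrow> (real ^ 'e) set" where
  "row_space A = span (rows A)"

definition signed_circuits :: "real ^ 'e ^ 'r \<Rightarrow> (real ^ 'e) set" where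
  "signed_circuits A =
     {x. x \<noteq> 0 \<and> A *v x = 0 \<and> (\<forall>e. x $ e \<in> {-1, 0, 1}) \<and> supp x \<in> circuits A}"

definition signed_cocircuits :: "real ^ 'e ^ 'r \<Rightarrow> (real ^ 'e) set" where
  "signed_cocircuits A =
     {x. x \<noteq> 0 \<and> x \<in> row_space A \<and> (\<forall>e. x $ e \<in> {-1, 0, 1}) \<and> supp x \<in> cocircuits A}"

definition circuit_signature :: "real ^ 'e ^ 'r \<Rightarrow> ('e set \<Rightarrow> real ^ 'e) \<Rightarrow> bool" where
  "circuit_signature A \<sigma> \<longleftrightarrow> (\<forall>C \<in> circuits A. \<sigma> C \<in> signed_circuits A \<and> supp (\<sigma> C) = C)"

definition cocircuit_signature :: "real ^ 'e ^ 'r \<Rightarrow> ('e set \<Rightarrow> real ^ 'e) \<Rightarrow> bool" where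
  "cocircuit_signature A \<sigma> \<longleftrightarrow>
     (\<forall>C \<in> cocircuits A. \<sigma> C \<in> signed_cocircuits A \<and> supp (\<sigma> C) = C)"

definition acyclic_on :: "'e set set \<Rightarrow> ('e set \<Rightarrow> real ^ 'e) \<Rightarrow> bool" where
  "acyclic_on \<C> \<sigma> \<longleftrightarrow>
     (\<forall>a :: 'e set \<Rightarrow> real. (\<forall>C \<in> \<C>. 0 \<le> a C) \<longrightarrow> (\<Sum>C \<in> \<C>. a C *\<^sub>R \<sigma> C) = 0 \<longrightarrow>
        (\<forall>C \<in> \<C>. a C = 0))"


section \<open>Orientations\<close>

definition is_orientation :: "('e \<Rightarrow> real) \<Rightarrow> bool" where
  "is_orientation Or \<longleftrightarrow> (\<forall>e. Or e \<in> {-1, 1})"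

definition compatible :: "('e \<Rightarrow> real) \<Rightarrow> real ^ 'e \<Rightarrow> bool" where
  "compatible Or x \<longleftrightarrow> (\<forall>e \<in> supp x. Or e = x $ e)"

definition compatible_orientations ::
  "real ^ 'e ^ 'r \<Rightarrow> ('e set \<Rightarrow> real ^ 'e) \<Rightarrow> ('e set \<Rightarrow> real ^ 'e) \<Rightarrow> ('e \<Rightarrow> real) set" where
  "compatible_orientations A \<sigma> \<sigma>' =
     {Or. is_orientation Or \<and>
          (\<forall>x \<in> signed_circuits A. compatible Or x \<longrightarrow> (\<exists>C \<in> circuits A. x = \<sigma> C)) \<and>
          (\<forall>x \<in> signed_cocircuits A. compatible Or x \<longrightarrow> (\<exists>C \<in> cocircuits A. x = \<sigma>' C))}"

definition psi :: "real ^ 'e ^ 'r \<Rightarrow> ('e \<Rightarrow> real) \<Rightarrow> real ^ 'r" where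
  "psi A Or = (\<Sum>e | Or e = 1. column e A)"

definition beta_hat ::
  "real ^ 'e ^ 'r \<Rightarrow> ('e set \<Rightarrow> real ^ 'e) \<Rightarrow> ('e set \<Rightarrow> real ^ 'e) \<Rightarrow> 'e set \<Rightarrow> 'e \<Rightarrow> real" where
  "beta_hat A \<sigma> \<sigma>' B =
     (\<lambda>e. if e \<in> B then \<sigma>' (fund_cocircuit A B e) $ e else \<sigma> (fund_circuit A B e) $ e)"


section \<open>Zonotopes\<close>

definition orth_proj :: "(real ^ 'e) set \<Rightarrow> real ^ 'e \<Rightarrow> real ^ 'e" where
  "orth_proj V x = (THE p. p \<in> V \<and> (\<forall>v \<in> V. orthogonal (x - p) v))"

definition row_zonotope :: "real ^ 'e ^ 'r \<Rightarrow> (real ^ 'e) set" where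
  "row_zonotope A =
     {(\<Sum>e \<in> UNIV. c e *\<^sub>R orth_proj (row_space A) (axis e 1)) | c. \<forall>e. 0 \<le> c e \<and> c e \<le> 1}"

definition lattice_points :: "real ^ 'e ^ 'r \<Rightarrow> (real ^ 'e) set" where
  "lattice_points A = {v \<in> row_space A. \<forall>i. (A *v v) $ i \<in> \<int>}"

definition basis_cell :: "real ^ 'e ^ 'r \<Rightarrow> ('e set \<Rightarrow> real ^ 'e) \<Rightarrow> 'e set \<Rightarrow> (real ^ 'r) set" where
  "basis_cell A \<sigma> B =
     {(\<Sum>e \<in> B. c e *\<^sub>R column e A) +
      (\<Sum>e | e \<notin> B \<and> \<sigma> (fund_circuit A B e) $ e = 1. column e A)
      | c. \<forall>e \<in> B. 0 \<le> c e \<and> c e \<le> 1}"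

definition row_basis_cell ::
  "real ^ 'e ^ 'r \<Rightarrow> ('e set \<Rightarrow> real ^ 'e) \<Rightarrow> 'e set \<Rightarrow> (real ^ 'e) set" where
  "row_basis_cell A \<sigma> B = {v \<in> row_space A. A *v v \<in> basis_cell A \<sigma> B}"

text \<open>
  For all sufficiently small positive \<open>\<epsilon>\<close>, the row cell of \<open>B\<close> translated by \<open>\<epsilon> w\<close> contains
  exactly one lattice point of the row zonotope, namely \<open>z\<close>; the point \<open>z\<close> is
  independent of \<open>\<epsilon>\<close>.
\<close>
definition is_shifted_point ::
  "real ^ 'e ^ 'r \<Rightarrow> ('e set \<Rightarrow> real ^ 'e) \<Rightarrow> real ^ 'e \<Rightarrow> 'e set \<Rightarrow> real ^ 'e \<Rightarrow> bool" where
  "is_shifted_point A \<sigma> w B z \<longleftrightarrow>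
     (\<forall>\<^sub>F \<epsilon> in at_right 0.
        (\<lambda>v. v + \<epsilon> *\<^sub>R w) ` row_basis_cell A \<sigma> B \<inter> (lattice_points A \<inter> row_zonotope A) = {z})"

definition shifted_point ::
  "real ^ 'e ^ 'r \<Rightarrow> ('e set \<Rightarrow> real ^ 'e) \<Rightarrow> real ^ 'e \<Rightarrow> 'e set \<Rightarrow> real ^ 'e" where
  "shifted_point A \<sigma> w B = (THE z. is_shifted_point A \<sigma> w B z)"

text \<open>The map \<open>\<phi>\<close>, sending \<open>B\<close> to the compatible orientation of its shifted lattice point.\<close>
definition phi ::
  "real ^ 'e ^ 'r \<Rightarrow> ('e set \<Rightarrow> real ^ 'e) \<Rightarrow> ('e set \<Rightarrow> real ^ 'e) \<Rightarrow> real ^ 'e \<Rightarrow>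
   'e set \<Rightarrow> 'e \<Rightarrow> real" where
  "phi A \<sigma> \<sigma>' w B =
     (THE Or. Or \<in> compatible_orientations A \<sigma> \<sigma>' \<and> psi A Or = A *v shifted_point A \<sigma> w B)"

end

theory Submission
  imports Defs
begin

text \<open>
  Let \<open>V\<close> be the kernel of \<open>A\<close>; its orthogonal complement is the row space. Circuits are the
  minimal supports of nonzero vectors of \<open>V\<close>, and cocircuits those of the row space, so each
  statement about circuits has a dual obtained by exchanging the two subspaces. Acyclicity of
  \<open>\<sigma>\<close> gives a vector \<open>p\<close> that is positive on all \<open>\<sigma> C\<close> (\<open>acyclic_on_positive\<close>), and \<open>w\<close> is
  positive on all \<open>\<sigma>' C\<close>.

  The orientation of a basis is compatible: a signed circuit compatible with it is a nonnegative
  combination of the chosen fundamental circuits, so \<open>p\<close> is positive on it and it cannot be a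
  negative \<open>- \<sigma> C\<close> (\<open>signature_compatible_of_fund_signs\<close>). A compatible orientation is determined
  by its value under \<open>psi\<close>: the difference of two orientations with the same value lies in
  \<open>V\<close>, and a signed circuit conformal to it is compatible with one of them while its negative is
  compatible with the other (\<open>signature_compatible_determined_mod_subspace\<close>).

  The bijection is linear programming duality. For an orientation \<open>Or\<close>, minimise \<open>p \<bullet> x\<close> over the
  points \<open>x\<close> of \<open>w + V\<close> whose entries have the signs of \<open>Or\<close>. The fundamental cocircuits show
  that the point of \<open>w + V\<close> supported on \<open>B\<close> has the signs of the orientation of \<open>B\<close>, and the
  fundamental circuits show that it is then the unique minimiser
  (\<open>basic_solution_optimal\<close>); this gives injectivity. Conversely, for a compatible \<open>Or\<close> the program
  is feasible by Farkas' lemma (\<open>feasible_exists\<close>), and a vertex of least cost has a basis as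
  its support and \<open>Or\<close> as its orientation, since otherwise a pivot would improve it
  (\<open>optimal_vertex_orient\<close>).

  The same point of \<open>w + V\<close> supported on \<open>B\<close> gives the coordinates of \<open>A w\<close> in the basis \<open>B\<close>.
  Total unimodularity makes the basis coordinates of a lattice point integral
  (\<open>integral_coordinates\<close>). A small shift by \<open>w\<close> therefore leaves in the cell exactly the vertex
  selected by the signs of these coordinates, which is the image of the orientation of \<open>B\<close>
  (\<open>shifted_cell_lattice_points\<close>).
\<close>

section \<open>Circuits of a linear subspace\<close>

text \<open>
  For the kernel of a matrix this is independence of columns; for its row space it is
  independence in the dual matroid. Circuits and cocircuits are therefore treated by the same
  lemmas, applied to a subspace and to its orthogonal complement.
\<close>
definition indep_in :: "(real ^ 'e) set \<Rightarrow> 'e set \<Rightarrow> bool" where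
  "indep_in V I \<longleftrightarrow> (\<forall>x \<in> V. supp x \<subseteq> I \<longrightarrow> x = 0)"

abbreviation circuits_in :: "(real ^ 'e) set \<Rightarrow> 'e set set" where
  "circuits_in V \<equiv> circuits_of (indep_in V)"

definition fund :: "(real ^ 'e) set \<Rightarrow> 'e set \<Rightarrow> 'e \<Rightarrow> 'e set" where
  "fund V B e = (THE C. C \<in> circuits_in V \<and> C \<subseteq> insert e B)"

definition signed_in :: "(real ^ 'e) set \<Rightarrow> (real ^ 'e) set" where
  "signed_in V = {x \<in> V. x \<noteq> 0 \<and> (\<forall>e. x $ e \<in> {-1, 0, 1}) \<and> supp x \<in> circuits_in V}"

definition signature_compatible ::
  "(real ^ 'e) set \<Rightarrow> ('e set \<Rightarrow> real ^ 'e) \<Rightarrow> ('e \<Rightarrow> real) \<Rightarrow> bool" where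
  "signature_compatible V \<sigma> Or \<longleftrightarrow>
     (\<forall>x \<in> signed_in V. compatible Or x \<longrightarrow> (\<exists>C \<in> circuits_in V. x = \<sigma> C))"

definition conformal :: "real ^ 'e \<Rightarrow> real ^ 'e \<Rightarrow> bool" where
  "conformal x y \<longleftrightarrow> (\<forall>e. x $ e \<noteq> 0 \<longrightarrow> 0 < x $ e * y $ e)"

lemma supp_eq_empty_iff [simp]: "supp x = {} \<longleftrightarrow> x = 0"
  by (auto simp: supp_def vec_eq_iff)

lemma indep_in_mono: "indep_in V I \<Longrightarrow> J \<subseteq> I \<Longrightarrow> indep_in V J"
  by (auto simp: indep_in_def)

lemma dependent_contains_circuit:
  fixes S :: "'e::finite set"
  assumes "\<not> indep_in V S"
  shows "\<exists>C \<in> circuits_in V. C \<subseteq> S"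
  using finite[of S] assms
proof (induction S rule: finite_psubset_induct)
  case (psubset S)
  show ?case
  proof (cases "\<forall>D. D \<subset> S \<longrightarrow> indep_in V D")
    case True
    with psubset.prems show ?thesis by (auto simp: circuits_of_def)
  next
    case False
    then obtain D where "D \<subset> S" "\<not> indep_in V D" by blast
    from psubset.IH[OF this] \<open>D \<subset> S\<close> show ?thesis by blast
  qed
qed

lemma conformal_trans: "conformal x y \<Longrightarrow> conformal y z \<Longrightarrow> conformal x z"
  unfolding conformal_def
proof (intro allI impI)
  fix e
  assume h: "\<forall>e. x $ e \<noteq> 0 \<longrightarrow> 0 < x $ e * y $ e" "\<forall>e. y $ e \<noteq> 0 \<longrightarrow> 0 < y $ e * z $ e"
    and "x $ e \<noteq> 0"
  then have xy: "0 < x $ e * y $ e" by blast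
  then have "y $ e \<noteq> 0" by auto
  with h have "0 < y $ e * z $ e" by blast
  with xy show "0 < x $ e * z $ e" by (auto simp: zero_less_mult_iff)
qed

text \<open>
  The ratio test of the simplex method: moving from \<open>x\<close> along \<open>d\<close> until the first coordinate
  is about to change its sign. The weights \<open>s\<close> carry the sign pattern; a zero weight leaves a
  coordinate unconstrained.
\<close>
lemma ratio_test:
  fixes x d :: "real ^ 'e::finite"
  assumes nonneg: "\<And>e. 0 \<le> s e * x $ e"
    and ex: "\<exists>e. s e * d $ e < 0"
    and pos: "\<And>e. s e * d $ e < 0 \<Longrightarrow> 0 < s e * x $ e"
  obtains l f where "0 < l" "\<And>e. 0 \<le> s e * (x + l *\<^sub>R d) $ e"
    "s f * d $ f < 0" "(x + l *\<^sub>R d) $ f = 0"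
proof -
  define F where "F = {e. s e * d $ e < 0}"
  define q where "q e = (s e * x $ e) / (- (s e * d $ e))" for e
  have "finite F" "F \<noteq> {}" using ex by (auto simp: F_def)
  then have "finite (q ` F)" "q ` F \<noteq> {}" by auto
  from Min_in[OF this] obtain f where f: "f \<in> F" "Min (q ` F) = q f" by auto
  have le: "q f \<le> q e" if "e \<in> F" for e
    using f(2) Min_le[OF \<open>finite (q ` F)\<close>] that by (metis imageI)
  have neg: "s f * d $ f < 0" using f by (simp add: F_def)
  have q0: "0 < q f" using neg pos[OF neg] unfolding q_def by (intro divide_pos_pos) auto
  have "0 \<le> s e * (x + q f *\<^sub>R d) $ e" for e
  proof (cases "e \<in> F")
    case True
    then have n: "0 < - (s e * d $ e)" by (simp add: F_def)
    have "q f * (- (s e * d $ e)) \<le> s e * x $ e"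
      using le[OF True] n by (simp only: q_def[of e] pos_le_divide_eq)
    then show ?thesis by (simp add: algebra_simps)
  next
    case False
    then have "0 \<le> s e * d $ e" by (simp add: F_def)
    then have "0 \<le> q f * (s e * d $ e)" using q0 by simp
    then show ?thesis using nonneg[of e] by (simp add: algebra_simps)
  qed
  moreover have "(x + q f *\<^sub>R d) $ f = 0"
    using neg by (auto simp: q_def)
  ultimately show thesis using that[OF q0 _ neg] by blast
qed

text \<open>
  The ratio test with the signs of \<open>x\<close> itself as weights.
\<close>
lemma conformal_reduction:
  fixes x d :: "real ^ 'e::finite"
  assumes "supp d \<subseteq> supp x" and "0 < d $ e * x $ e"
  obtains l where "0 < l" "conformal (x - l *\<^sub>R d) x" "supp (x - l *\<^sub>R d) \<subset> supp x"
proof -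
  have sx: "0 < sgn (x $ e) * x $ e \<longleftrightarrow> x $ e \<noteq> 0" for e
    by (simp add: sgn_if)
  have neg: "\<exists>e. sgn (x $ e) * (- d) $ e < 0"
    using assms(2) by (intro exI[of _ e]) (auto simp: sgn_if zero_less_mult_iff)
  have pos: "0 < sgn (x $ e) * x $ e" if "sgn (x $ e) * (- d) $ e < 0" for e
    using that by (auto simp: sgn_if split: if_splits)
  have nonneg: "0 \<le> sgn (x $ e) * x $ e" for e by (simp add: sgn_if)
  obtain l f where l: "0 < l" "\<And>e. 0 \<le> sgn (x $ e) * (x + l *\<^sub>R (- d)) $ e"
    "sgn (x $ f) * (- d) $ f < 0" "(x + l *\<^sub>R (- d)) $ f = 0"
    using ratio_test[of "\<lambda>e. sgn (x $ e)" x "- d", OF nonneg neg pos] by blast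
  have sub: "x $ e \<noteq> 0" if "(x - l *\<^sub>R d) $ e \<noteq> 0" for e
    using that assms(1) by (auto simp: supp_def)
  have "conformal (x - l *\<^sub>R d) x"
    unfolding conformal_def
  proof (intro allI impI)
    fix e assume n: "(x - l *\<^sub>R d) $ e \<noteq> 0"
    then show "0 < (x - l *\<^sub>R d) $ e * x $ e"
      using sub[OF n] l(2)[of e] by (auto simp: sgn_if zero_less_mult_iff split: if_splits)
  qed
  moreover have "f \<in> supp x" "f \<notin> supp (x - l *\<^sub>R d)"
    using l(3,4) by (auto simp: supp_def)
  moreover have "supp (x - l *\<^sub>R d) \<subseteq> supp x"
    using sub by (auto simp: supp_def)
  ultimately show thesis using that[OF l(1)] by blast
qed

text \<open>
  Gordan's alternative: acyclicity says that \<open>0\<close> is not in the convex hull of the chosen vectors, so a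
  hyperplane separates it from them.
\<close>
lemma acyclic_on_positive:
  fixes \<sigma> :: "'e::finite set \<Rightarrow> real ^ 'e"
  assumes inj: "inj_on \<sigma> \<C>" and acyclic: "acyclic_on \<C> \<sigma>"
  obtains p where "\<And>C. C \<in> \<C> \<Longrightarrow> 0 < p \<bullet> \<sigma> C"
proof -
  have "0 \<notin> convex hull (\<sigma> ` \<C>)"
  proof
    assume "0 \<in> convex hull (\<sigma> ` \<C>)"
    then obtain u where u: "\<forall>x \<in> \<sigma> ` \<C>. 0 \<le> u x" "sum u (\<sigma> ` \<C>) = 1"
      "(\<Sum>x \<in> \<sigma> ` \<C>. u x *\<^sub>R x) = 0"
      by (auto simp: convex_hull_finite)
    have "(\<Sum>C \<in> \<C>. u (\<sigma> C) *\<^sub>R \<sigma> C) = 0" using u(3) by (simp add: sum.reindex[OF inj])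
    moreover have "\<forall>C \<in> \<C>. 0 \<le> u (\<sigma> C)" using u(1) by blast
    ultimately have "\<forall>C \<in> \<C>. u (\<sigma> C) = 0"
      using acyclic[unfolded acyclic_on_def, rule_format, of "\<lambda>C. u (\<sigma> C)"] by blast
    then have "sum u (\<sigma> ` \<C>) = 0" by (intro sum.neutral) auto
    then show False using u(2) by simp
  qed
  moreover have "closed (convex hull (\<sigma> ` \<C>))"
    by (intro compact_imp_closed finite_imp_compact_convex_hull) simp
  ultimately obtain p b where "0 < b" "\<forall>x \<in> convex hull (\<sigma> ` \<C>). b < p \<bullet> x"
    using separating_hyperplane_closed_0[OF convex_convex_hull] by blast
  then have "0 < p \<bullet> \<sigma> C" if "C \<in> \<C>" for C
    using that hull_inc[of "\<sigma> C" "\<sigma> ` \<C>" convex] by fastforce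
  then show thesis using that by blast
qed

text \<open>
  Acyclicity of \<open>\<sigma>\<close> is used in the form of a vector \<open>p\<close> that is positive on all chosen signed
  circuits. For the cocircuits the given \<open>w\<close> is such a vector.
\<close>
locale positive_signature =
  fixes V :: "(real ^ 'e::finite) set" and \<sigma> :: "'e set \<Rightarrow> real ^ 'e" and p :: "real ^ 'e"
  assumes subspace: "subspace V"
    and sig_mem: "C \<in> circuits_in V \<Longrightarrow> \<sigma> C \<in> V"
    and sig_entry: "C \<in> circuits_in V \<Longrightarrow> \<sigma> C $ e \<in> {-1, 0, 1}"
    and sig_supp: "C \<in> circuits_in V \<Longrightarrow> supp (\<sigma> C) = C"
    and sig_pos: "C \<in> circuits_in V \<Longrightarrow> 0 < p \<bullet> \<sigma> C"
begin

lemma circuit_nonempty: "C \<in> circuits_in V \<Longrightarrow> C \<noteq> {}"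
  by (auto simp: circuits_of_def indep_in_def)

lemma sig_signed:
  assumes "C \<in> circuits_in V"
  shows "\<sigma> C \<in> signed_in V"
proof -
  have "\<sigma> C \<noteq> 0"
    using sig_supp[OF assms] circuit_nonempty[OF assms] supp_eq_empty_iff by metis
  then show ?thesis
    using sig_mem[OF assms] sig_entry[OF assms] sig_supp[OF assms] assms
    by (simp add: signed_in_def)
qed

lemma uminus_signed:
  assumes "x \<in> signed_in V"
  shows "- x \<in> signed_in V"
proof -
  have "supp (- x) = supp x" by (simp add: supp_def)
  moreover have "- x $ e \<in> {-1, 0, 1}" for e
    using assms by (auto simp: signed_in_def)
  ultimately show ?thesis
    using assms subspace_neg[OF subspace, of x] by (simp add: signed_in_def)
qed

lemma sig_nonzero_iff: "C \<in> circuits_in V \<Longrightarrow> \<sigma> C $ e \<noteq> 0 \<longleftrightarrow> e \<in> C"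
  using sig_supp[of C] by (auto simp: supp_def)

lemma sig_unit: "C \<in> circuits_in V \<Longrightarrow> e \<in> C \<Longrightarrow> \<sigma> C $ e = 1 \<or> \<sigma> C $ e = -1"
  using sig_nonzero_iff[of C e] sig_entry[of C e] by auto

text \<open>
  Subtracting the multiple that cancels one coordinate leaves a vector supported on a proper
  subset of a circuit.
\<close>
lemma circuit_line:
  assumes C: "C \<in> circuits_in V" and x: "x \<in> V" "supp x \<subseteq> C"
  shows "\<exists>c. x = c *\<^sub>R \<sigma> C"
proof -
  obtain e where e: "e \<in> C" using circuit_nonempty[OF C] by blast
  define c where "c = x $ e / \<sigma> C $ e"
  have ne: "\<sigma> C $ e \<noteq> 0" using sig_nonzero_iff[OF C] e by simp
  have "x - c *\<^sub>R \<sigma> C \<in> V"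
    using x sig_mem[OF C] subspace by (simp add: subspace_diff subspace_scale)
  moreover have "(x - c *\<^sub>R \<sigma> C) $ f = 0" if "f \<notin> C - {e}" for f
    using that x(2) sig_nonzero_iff[OF C, of f] ne by (cases "f = e") (auto simp: supp_def c_def)
  then have "supp (x - c *\<^sub>R \<sigma> C) \<subseteq> C - {e}" by (auto simp: supp_def)
  moreover have "indep_in V (C - {e})"
    using C e by (auto simp: circuits_of_def)
  ultimately have "x - c *\<^sub>R \<sigma> C = 0" unfolding indep_in_def by blast
  then show ?thesis by auto
qed

lemma signed_cases:
  assumes "x \<in> signed_in V"
  shows "x = \<sigma> (supp x) \<or> x = - \<sigma> (supp x)"
proof -
  have C: "supp x \<in> circuits_in V" and x: "x \<in> V" "\<And>e. x $ e \<in> {-1, 0, 1}"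
    using assms by (auto simp: signed_in_def)
  obtain c where c: "x = c *\<^sub>R \<sigma> (supp x)" using circuit_line[OF C x(1)] by blast
  obtain e where e: "e \<in> supp x" using circuit_nonempty[OF C] by blast
  have "x $ e = c * \<sigma> (supp x) $ e" by (subst c) simp
  moreover have "x $ e = 1 \<or> x $ e = -1" using e x(2)[of e] by (auto simp: supp_def)
  ultimately have "c = 1 \<or> c = -1" using sig_unit[OF C e] by auto
  then show ?thesis using c by auto
qed

lemma signature_compatible_sig:
  assumes "signature_compatible V \<sigma> Or" "x \<in> signed_in V" "compatible Or x"
  shows "x = \<sigma> (supp x)"
  using assms sig_supp unfolding signature_compatible_def by metis

text \<open>
  Subtract from \<open>x\<close> a suitable multiple of any circuit inside its support: the support shrinks
  and the signs survive, so induction applies. If nothing is left, that circuit is itself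
  conformal to \<open>x\<close>.
\<close>
lemma exists_conformal_circuit:
  assumes "x \<in> V" "x \<noteq> 0"
  shows "\<exists>d \<in> signed_in V. conformal d x"
  using assms
proof (induction "card (supp x)" arbitrary: x rule: less_induct)
  case less
  then have "\<not> indep_in V (supp x)" by (auto simp: indep_in_def)
  then obtain C where C: "C \<in> circuits_in V" "C \<subseteq> supp x"
    using dependent_contains_circuit by blast
  obtain e where e: "e \<in> C" using circuit_nonempty[OF C(1)] by blast
  obtain d where d: "d \<in> signed_in V" "supp d = C" "0 < d $ e * x $ e"
  proof (cases "0 < \<sigma> C $ e * x $ e")
    case True
    with that sig_signed sig_supp C(1) show thesis by blast
  next
    case False
    have "\<sigma> C $ e \<noteq> 0" "x $ e \<noteq> 0"
      using sig_nonzero_iff[OF C(1)] C(2) e by (auto simp: supp_def)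
    with False have "0 < (- \<sigma> C) $ e * x $ e"
      by (auto simp: zero_less_mult_iff mult_less_0_iff)
    moreover have "supp (- \<sigma> C) = C" using sig_supp[OF C(1)] by (simp add: supp_def)
    ultimately show thesis using that uminus_signed[OF sig_signed[OF C(1)]] by blast
  qed
  then have "supp d \<subseteq> supp x" using C by simp
  then obtain l where l: "0 < l" "conformal (x - l *\<^sub>R d) x" "supp (x - l *\<^sub>R d) \<subset> supp x"
    using conformal_reduction d(3) by blast
  show ?case
  proof (cases "x - l *\<^sub>R d = 0")
    case True
    then have "x = l *\<^sub>R d" by simp
    then have "conformal d x"
      using l(1) by (auto simp: conformal_def zero_less_mult_iff mult_pos_neg)
    then show ?thesis using d(1) by blast
  next
    case False
    have "x - l *\<^sub>R d \<in> V"
      using less.prems d(1) subspace by (simp add: signed_in_def subspace_diff subspace_scale)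
    moreover have "card (supp (x - l *\<^sub>R d)) < card (supp x)"
      using l(3) by (simp add: psubset_card_mono)
    ultimately obtain d' where "d' \<in> signed_in V" "conformal d' (x - l *\<^sub>R d)"
      using less.hyps False by blast
    then show ?thesis using conformal_trans l(2) by blast
  qed
qed

text \<open>
  Peeling off conformal circuits one after the other writes \<open>x\<close> as a nonnegative combination
  of signed circuits conformal to it.
\<close>
lemma positive_if_conformal_positive:
  assumes "x \<in> V" "x \<noteq> 0" and "\<And>d. d \<in> signed_in V \<Longrightarrow> conformal d x \<Longrightarrow> 0 < q \<bullet> d"
  shows "0 < q \<bullet> x"
  using assms
proof (induction "card (supp x)" arbitrary: x rule: less_induct)
  case less
  obtain d where d: "d \<in> signed_in V" "conformal d x"
    using exists_conformal_circuit less.prems by blast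
  then obtain e where e: "0 < d $ e * x $ e"
    by (auto simp: signed_in_def conformal_def vec_eq_iff)
  have "supp d \<subseteq> supp x"
    using d(2) by (auto simp: conformal_def supp_def)
  then obtain l where l: "0 < l" "conformal (x - l *\<^sub>R d) x" "supp (x - l *\<^sub>R d) \<subset> supp x"
    using conformal_reduction e by blast
  have qd: "0 < q \<bullet> d" using less.prems d by blast
  have "0 \<le> q \<bullet> (x - l *\<^sub>R d)"
  proof (cases "x - l *\<^sub>R d = 0")
    case False
    have "x - l *\<^sub>R d \<in> V"
      using less.prems d(1) subspace by (simp add: signed_in_def subspace_diff subspace_scale)
    moreover have "card (supp (x - l *\<^sub>R d)) < card (supp x)"
      using l(3) by (simp add: psubset_card_mono)
    moreover have "0 < q \<bullet> d'" if "d' \<in> signed_in V" "conformal d' (x - l *\<^sub>R d)" for d'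
      using less.prems(3) that conformal_trans l(2) by blast
    ultimately show ?thesis using less.hyps False by (simp add: less_imp_le)
  qed simp
  moreover have "0 < l * (q \<bullet> d)" using l(1) qd by simp
  ultimately show ?case by (simp add: inner_diff_right)
qed

lemma fund_circuit_unique:
  assumes B: "indep_in V B"
    and C: "C \<in> circuits_in V" "C \<subseteq> insert e B" and D: "D \<in> circuits_in V" "D \<subseteq> insert e B"
  shows "C = D"
proof -
  have mem: "e \<in> C" if "C \<in> circuits_in V" "C \<subseteq> insert e B" for C
    using that indep_in_mono[OF B, of C] by (auto simp: circuits_of_def)
  have eC: "\<sigma> C $ e \<noteq> 0" and eD: "\<sigma> D $ e \<noteq> 0"
    using mem C D sig_nonzero_iff by auto
  define c where "c = \<sigma> C $ e / \<sigma> D $ e"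
  have "\<sigma> C - c *\<^sub>R \<sigma> D \<in> V"
    using sig_mem C(1) D(1) subspace by (simp add: subspace_diff subspace_scale)
  moreover have "supp (\<sigma> C - c *\<^sub>R \<sigma> D) \<subseteq> B"
  proof
    fix f assume f: "f \<in> supp (\<sigma> C - c *\<^sub>R \<sigma> D)"
    then have "f \<noteq> e" using eD by (auto simp: supp_def c_def)
    moreover have "f \<in> C \<or> f \<in> D"
      using f sig_nonzero_iff[OF C(1), of f] sig_nonzero_iff[OF D(1), of f] by (auto simp: supp_def)
    ultimately show "f \<in> B" using C(2) D(2) by auto
  qed
  ultimately have "\<sigma> C - c *\<^sub>R \<sigma> D = 0" using B unfolding indep_in_def by blast
  then have eq: "\<sigma> C = c *\<^sub>R \<sigma> D" by simp
  have "c \<noteq> 0" using eC eD by (simp add: c_def)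
  then have "supp (\<sigma> C) = supp (\<sigma> D)" by (simp add: eq supp_def)
  then show ?thesis using sig_supp C(1) D(1) by simp
qed

lemma fund_circuit:
  assumes B: "indep_in V B" and e: "\<not> indep_in V (insert e B)"
  shows "fund V B e \<in> circuits_in V" "fund V B e \<subseteq> insert e B" "e \<in> fund V B e"
proof -
  obtain C where C: "C \<in> circuits_in V" "C \<subseteq> insert e B"
    using dependent_contains_circuit[OF e] by blast
  have eq: "fund V B e = C"
    unfolding fund_def using C fund_circuit_unique[OF B] by (intro the_equality) auto
  show "fund V B e \<in> circuits_in V" "fund V B e \<subseteq> insert e B" using C eq by auto
  show "e \<in> fund V B e"
    using C indep_in_mono[OF B, of C] eq by (auto simp: circuits_of_def)
qed

lemma fund_circuit_entry:
  assumes "indep_in V B" and "\<not> indep_in V (insert e B)"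
  shows "\<sigma> (fund V B e) $ e = 1 \<or> \<sigma> (fund V B e) $ e = -1"
  using sig_unit fund_circuit[OF assms] by blast

lemma fund_circuit_other:
  assumes "indep_in V B" and "\<not> indep_in V (insert e B)" and "f \<notin> B" "f \<noteq> e"
  shows "\<sigma> (fund V B e) $ f = 0"
  using sig_nonzero_iff fund_circuit[OF assms(1,2)] assms(3,4) by blast

text \<open>
  The difference of the two sides vanishes outside \<open>B\<close>, because among the fundamental circuits
  only that of \<open>e\<close> contains \<open>e\<close>.
\<close>
lemma fund_circuit_expansion:
  assumes B: "indep_in V B" and dep: "\<And>e. e \<notin> B \<Longrightarrow> \<not> indep_in V (insert e B)" and x: "x \<in> V"
  shows "x = (\<Sum>e \<in> - B. (x $ e * \<sigma> (fund V B e) $ e) *\<^sub>R \<sigma> (fund V B e))" (is "x = ?y")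
proof -
  have "?y \<in> V"
    using fund_circuit(1)[OF B dep] sig_mem subspace
    by (intro subspace_sum) (auto intro: subspace_scale)
  then have "x - ?y \<in> V" using x subspace by (simp add: subspace_diff)
  moreover have "(x - ?y) $ f = 0" if f: "f \<notin> B" for f
  proof -
    have "?y $ f = (\<Sum>e \<in> - B. x $ e * \<sigma> (fund V B e) $ e * \<sigma> (fund V B e) $ f)"
      by simp
    also have "\<dots> = (\<Sum>e \<in> - B. if e = f then x $ f else 0)"
    proof (rule sum.cong)
      fix e assume e: "e \<in> - B"
      show "x $ e * \<sigma> (fund V B e) $ e * \<sigma> (fund V B e) $ f = (if e = f then x $ f else 0)"
        using fund_circuit_other[OF B dep f, of e] fund_circuit_entry[OF B dep, of e] e by auto
    qed simp
    also have "\<dots> = x $ f" using f by simp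
    finally show ?thesis by simp
  qed
  then have "supp (x - ?y) \<subseteq> B" unfolding supp_def by blast
  ultimately have "x - ?y = 0" using B unfolding indep_in_def by blast
  then show ?thesis by simp
qed

lemma inner_fund_circuit_expansion:
  assumes B: "indep_in V B" and dep: "\<And>e. e \<notin> B \<Longrightarrow> \<not> indep_in V (insert e B)" and x: "x \<in> V"
  shows "p \<bullet> x = (\<Sum>e \<in> - B. x $ e * \<sigma> (fund V B e) $ e * (p \<bullet> \<sigma> (fund V B e)))"
  by (subst fund_circuit_expansion[OF B dep x]) (simp_all add: inner_sum_right)

text \<open>
  All terms of the expansion in fundamental circuits have nonnegative coefficients. Both the
  compatibility of the orientation of a basis and the optimality of its basic solution follow.
\<close>
lemma inner_pos_of_fund_signs:
  assumes B: "indep_in V B" and dep: "\<And>e. e \<notin> B \<Longrightarrow> \<not> indep_in V (insert e B)"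
    and x: "x \<in> V" "x \<noteq> 0"
    and sign: "\<And>e. e \<notin> B \<Longrightarrow> 0 \<le> x $ e * \<sigma> (fund V B e) $ e"
  shows "0 < p \<bullet> x"
proof -
  have "\<not> supp x \<subseteq> B" using B x by (auto simp: indep_in_def)
  then obtain e where e: "e \<notin> B" "x $ e \<noteq> 0" by (auto simp: supp_def)
  then have "x $ e * \<sigma> (fund V B e) $ e > 0"
    using sign[OF e(1)] fund_circuit_entry[OF B dep[OF e(1)]] by auto
  then have "0 < x $ e * \<sigma> (fund V B e) $ e * (p \<bullet> \<sigma> (fund V B e))"
    using fund_circuit(1)[OF B dep[OF e(1)]] sig_pos by simp
  then show ?thesis
    unfolding inner_fund_circuit_expansion[OF B dep x(1), simplified]
    using e sign fund_circuit(1)[OF B dep] sig_pos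
    by (intro sum_pos2[of _ e]) (auto intro!: mult_nonneg_nonneg simp: less_imp_le)
qed

text \<open>
  A compatible signed circuit \<open>x\<close> is a nonnegative combination of chosen fundamental circuits, so
  \<open>p \<bullet> x > 0\<close>; this excludes \<open>x = - \<sigma> (supp x)\<close>.
\<close>
lemma signature_compatible_of_fund_signs:
  assumes B: "indep_in V B" and dep: "\<And>e. e \<notin> B \<Longrightarrow> \<not> indep_in V (insert e B)"
    and Or: "\<And>e. e \<notin> B \<Longrightarrow> Or e = \<sigma> (fund V B e) $ e"
  shows "signature_compatible V \<sigma> Or"
  unfolding signature_compatible_def
proof (intro ballI impI)
  fix x assume x: "x \<in> signed_in V" and "compatible Or x"
  then have "0 \<le> x $ e * \<sigma> (fund V B e) $ e" if "e \<notin> B" for e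
    using Or[OF that] by (cases "x $ e = 0") (auto simp: compatible_def supp_def)
  then have "0 < p \<bullet> x"
    using x by (intro inner_pos_of_fund_signs[OF B dep]) (auto simp: signed_in_def)
  moreover have C: "supp x \<in> circuits_in V" using x by (simp add: signed_in_def)
  ultimately have "x \<noteq> - \<sigma> (supp x)"
    using sig_pos[of "supp x"] by (metis inner_minus_right neg_0_less_iff_less order_less_asym)
  then show "\<exists>C \<in> circuits_in V. x = \<sigma> C" using signed_cases[OF x] C by blast
qed

text \<open>
  A signed circuit \<open>d\<close> conformal to the difference is compatible with \<open>Or\<close>, and \<open>- d\<close> is
  compatible with \<open>Or'\<close>, but the signature admits only one of the two.
\<close>
lemma signature_compatible_determined_mod_subspace:
  assumes "is_orientation Or" "is_orientation Or'" and "signature_compatible V \<sigma> Or" "signature_compatible V \<sigma> Or'"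
    and diff: "(\<chi> e. Or e - Or' e) \<in> V"
  shows "Or = Or'"
proof (rule ccontr)
  assume "Or \<noteq> Or'"
  then have "(\<chi> e. Or e - Or' e) \<noteq> 0" by (auto simp: vec_eq_iff)
  then obtain d where d: "d \<in> signed_in V" "conformal d (\<chi> e. Or e - Or' e)"
    using exists_conformal_circuit diff by blast
  have val: "Or e = d $ e \<and> Or' e = - d $ e" if "d $ e \<noteq> 0" for e
  proof -
    have "0 < d $ e * (Or e - Or' e)" using d(2) that by (auto simp: conformal_def)
    moreover have "Or e = 1 \<or> Or e = -1" "Or' e = 1 \<or> Or' e = -1" "d $ e = 1 \<or> d $ e = -1"
      using assms(1,2) d(1) that by (auto simp: is_orientation_def signed_in_def)
    ultimately show ?thesis by auto
  qed
  have sd: "supp (- d) = supp d" by (simp add: supp_def)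
  have "- d \<in> signed_in V" by (rule uminus_signed[OF d(1)])
  moreover have "compatible Or d" "compatible Or' (- d)"
    using val by (auto simp: compatible_def supp_def)
  ultimately have "d = \<sigma> (supp d)" "- d = \<sigma> (supp d)"
    using signature_compatible_sig assms(3,4) d(1) sd by metis+
  then have "d = - d" by simp
  then have "d = 0" by (simp add: vec_eq_iff)
  then show False using d(1) by (simp add: signed_in_def)
qed

end


section \<open>Orthogonal complements and matroid duality\<close>

text \<open>
  A symmetric description of a basis: passing to the orthogonal complement of \<open>V\<close> and to the
  complement of \<open>B\<close> exchanges the two conditions.
\<close>
definition base_in :: "(real ^ 'e) set \<Rightarrow> 'e set \<Rightarrow> bool" where
  "base_in V B \<longleftrightarrow> indep_in V B \<and> indep_in (orthogonal_comp V) (- B)"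

lemma orthogonal_compD: "x \<in> V \<Longrightarrow> y \<in> orthogonal_comp V \<Longrightarrow> x \<bullet> y = 0"
  by (auto simp: orthogonal_comp_def orthogonal_def)

lemma inner_single:
  fixes x y :: "real ^ 'e::finite"
  assumes "\<And>f. f \<noteq> e \<Longrightarrow> x $ f = 0 \<or> y $ f = 0"
  shows "x \<bullet> y = x $ e * y $ e"
proof -
  have "x \<bullet> y = (\<Sum>f \<in> {e}. x $ f * y $ f)"
    unfolding inner_vec_def inner_real_def using assms by (intro sum.mono_neutral_right) auto
  then show ?thesis by simp
qed

text \<open>
  The orthogonal complement of \<open>V + \<real>\<^sup>B\<close> consists of the vectors of \<open>V\<^sup>\<bottom>\<close> that vanish on
  \<open>B\<close>. If there are none but zero, then \<open>V\<close> projects onto the coordinates outside \<open>B\<close>.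
\<close>
lemma coordinate_extension:
  fixes V :: "(real ^ 'e::finite) set" and z :: "real ^ 'e"
  assumes V: "subspace V" and B: "indep_in (orthogonal_comp V) (- B)"
  obtains x where "x \<in> V" "\<And>e. e \<notin> B \<Longrightarrow> x $ e = z $ e"
proof -
  define R where "R = {x :: real ^ 'e. supp x \<subseteq> B}"
  have R: "subspace R"
    unfolding subspace_def R_def supp_def by (auto, force+)
  define U where "U = {x + y | x y. x \<in> V \<and> y \<in> R}"
  have U: "subspace U" unfolding U_def by (rule subspace_sums[OF V R])
  have VU: "V \<subseteq> U" and RU: "R \<subseteq> U"
    using subspace_0[OF V] subspace_0[OF R] unfolding U_def by force+
  have "y = 0" if y: "y \<in> orthogonal_comp U" for y
  proof -
    have "y $ e = 0" if "e \<in> B" for e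
    proof -
      have "axis e 1 \<in> R" using that by (auto simp: R_def supp_def axis_def split: if_splits)
      then have "axis e 1 \<in> U" using RU by blast
      then show ?thesis using orthogonal_compD[OF _ y] by (force simp: inner_axis')
    qed
    then have "supp y \<subseteq> - B" by (auto simp: supp_def)
    moreover have "y \<in> orthogonal_comp V" using y orthogonal_comp_anti_mono[OF VU] by blast
    ultimately show ?thesis using B by (auto simp: indep_in_def)
  qed
  then have "orthogonal_comp U = {0}"
    using subspace_0[OF subspace_orthogonal_comp] by blast
  then have "U = UNIV"
    using orthogonal_comp_self[OF U] by (metis orthogonal_comp_null)
  then obtain x y where "x \<in> V" "y \<in> R" "z = x + y" unfolding U_def by blast
  then show thesis using that[of x] by (auto simp: R_def supp_def)
qed

lemma base_in_dependent:
  fixes V :: "(real ^ 'e::finite) set"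
  assumes V: "subspace V" and B: "base_in V B" and e: "e \<notin> B"
  shows "\<not> indep_in V (insert e B)"
proof -
  obtain x where x: "x \<in> V" "\<And>f. f \<notin> B \<Longrightarrow> x $ f = axis e (1::real) $ f"
    using coordinate_extension[OF V, of B "axis e 1"] B by (auto simp: base_in_def)
  have "x $ e = 1" using x(2)[OF e] by simp
  moreover have "supp x \<subseteq> insert e B" using x(2) by (auto simp: supp_def axis_def split: if_splits)
  ultimately show ?thesis using x(1) unfolding indep_in_def by (metis zero_index zero_neq_one)
qed

lemma base_in_compl:
  assumes "subspace V"
  shows "base_in (orthogonal_comp V) (- B) \<longleftrightarrow> base_in V B"
  by (auto simp: base_in_def orthogonal_comp_self[OF assms])

text \<open>
  For \<open>f \<in> S - B\<close> some vector of \<open>V\<close> lives on \<open>insert f B\<close> and uses \<open>f\<close>; its inner product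
  with \<open>y\<close> sees only the coordinate \<open>f\<close>.
\<close>
lemma spans_of_maximal:
  fixes V :: "(real ^ 'e::finite) set"
  assumes B: "indep_in V B" and dep: "\<And>f. f \<in> S - B \<Longrightarrow> \<not> indep_in V (insert f B)"
    and y: "y \<in> orthogonal_comp V" "supp y \<inter> B = {}"
  shows "supp y \<inter> S = {}"
proof -
  have "y $ f = 0" if f: "f \<in> S - B" for f
  proof -
    obtain x where x: "x \<in> V" "supp x \<subseteq> insert f B" "x \<noteq> 0"
      using dep[OF f] by (auto simp: indep_in_def)
    then have "x $ f \<noteq> 0" using B by (auto simp: indep_in_def supp_def)
    moreover have "x \<bullet> y = x $ f * y $ f"
      using x(2) y(2) by (intro inner_single) (auto simp: supp_def)
    ultimately show ?thesis using orthogonal_compD[OF x(1) y(1)] by simp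
  qed
  then show ?thesis using y(2) by (auto simp: supp_def)
qed

lemma bases_of_indep_in:
  fixes V :: "(real ^ 'e::finite) set"
  assumes V: "subspace V"
  shows "B \<in> bases_of (indep_in V) \<longleftrightarrow> base_in V B"
proof
  assume B: "B \<in> bases_of (indep_in V)"
  then have "indep_in V B" by (simp add: bases_of_def)
  moreover have "\<not> indep_in V (insert f B)" if "f \<in> UNIV - B" for f
    using B that by (auto simp: bases_of_def)
  ultimately have "supp y \<inter> UNIV = {}" if "y \<in> orthogonal_comp V" "supp y \<inter> B = {}" for y
    using spans_of_maximal that by blast
  then have "indep_in (orthogonal_comp V) (- B)" by (auto simp: indep_in_def)
  with \<open>indep_in V B\<close> show "base_in V B" by (simp add: base_in_def)
next
  assume B: "base_in V B"
  have "I = B" if I: "indep_in V I" "B \<subseteq> I" for I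
  proof (rule ccontr)
    assume "I \<noteq> B"
    then obtain e where "e \<in> I" "e \<notin> B" using I(2) by blast
    then show False using base_in_dependent[OF V B] indep_in_mono[OF I(1), of "insert e B"] I(2)
      by auto
  qed
  then show "B \<in> bases_of (indep_in V)" using B by (auto simp: bases_of_def base_in_def)
qed

text \<open>
  If \<open>I\<close> is independent for the orthogonal complement, then a maximal independent subset of
  \<open>- I\<close> is already a basis.
\<close>
lemma dual_indep_in:
  fixes V :: "(real ^ 'e::finite) set"
  assumes V: "subspace V"
  shows "dual_indep (indep_in V) = indep_in (orthogonal_comp V)"
proof (intro ext iffI)
  fix I assume "dual_indep (indep_in V) I"
  then show "indep_in (orthogonal_comp V) I"
    using bases_of_indep_in[OF V] indep_in_mono[of "orthogonal_comp V"]
    by (fastforce simp: dual_indep_def base_in_def)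
next
  fix I assume I: "indep_in (orthogonal_comp V) I"
  have "indep_in V {}" by (simp add: indep_in_def)
  define F where "F = {B. B \<subseteq> - I \<and> indep_in V B}"
  have "finite F" by simp
  moreover have "F \<noteq> {}" using \<open>indep_in V {}\<close> by (auto simp: F_def)
  ultimately obtain B where "B \<in> F" and maxF: "\<forall>C \<in> F. B \<subseteq> C \<longrightarrow> B = C"
    using finite_has_maximal by metis
  then have B: "B \<subseteq> - I" "indep_in V B" by (simp_all add: F_def)
  have max: "B = C" if "C \<subseteq> - I" "indep_in V C" "B \<subseteq> C" for C
    using maxF that by (simp add: F_def)
  have dep: "\<not> indep_in V (insert f B)" if "f \<in> - I - B" for f
    using max[of "insert f B"] B(1) that by blast
  have "y = 0" if y: "y \<in> orthogonal_comp V" "supp y \<subseteq> - B" for y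
  proof -
    have "supp y \<inter> B = {}" using y(2) by blast
    from spans_of_maximal[of V B "- I" y, OF B(2) dep y(1) this] have "supp y \<inter> - I = {}" .
    then show ?thesis using I y(1) by (auto simp: indep_in_def)
  qed
  then have "base_in V B" using B(2) by (simp add: base_in_def indep_in_def)
  then show "dual_indep (indep_in V) I"
    using B(1) bases_of_indep_in[OF V] by (auto simp: dual_indep_def)
qed


section \<open>Bases as optimal vertices of linear programs\<close>

definition fund_orientation ::
  "(real ^ 'e) set \<Rightarrow> ('e set \<Rightarrow> real ^ 'e) \<Rightarrow> ('e set \<Rightarrow> real ^ 'e) \<Rightarrow> 'e set \<Rightarrow> 'e \<Rightarrow> real" where
  "fund_orientation V \<sigma> \<sigma>' B =
     (\<lambda>e. if e \<in> B then \<sigma>' (fund (orthogonal_comp V) (- B) e) $ e else \<sigma> (fund V B e) $ e)"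

definition compatible_in ::
  "(real ^ 'e) set \<Rightarrow> ('e set \<Rightarrow> real ^ 'e) \<Rightarrow> ('e set \<Rightarrow> real ^ 'e) \<Rightarrow> ('e \<Rightarrow> real) set" where
  "compatible_in V \<sigma> \<sigma>' =
     {Or. is_orientation Or \<and> signature_compatible V \<sigma> Or \<and> signature_compatible (orthogonal_comp V) \<sigma>' Or}"

text \<open>
  The linear program attached to an orientation \<open>Or\<close>: minimise \<open>p \<bullet> x\<close> over all \<open>x \<in> w + V\<close>
  whose entries have the signs prescribed by \<open>Or\<close>. Since \<open>w\<close> has nonzero inner product with every
  signed cocircuit, the program is nondegenerate. The basic solution of \<open>B\<close> is the point of
  \<open>w + V\<close> supported on \<open>B\<close>; the cocircuit half of \<open>orient B = Or\<close> says that it is feasible, and the circuit half that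
  its reduced costs are positive.
\<close>
locale dual_signatures =
  prim: positive_signature V \<sigma> p + dual: positive_signature "orthogonal_comp V" \<sigma>' w
  for V :: "(real ^ 'e::finite) set" and \<sigma> p \<sigma>' w
begin

abbreviation orient :: "'e set \<Rightarrow> 'e \<Rightarrow> real" where
  "orient \<equiv> fund_orientation V \<sigma> \<sigma>'"

lemma prim_base:
  assumes "base_in V B"
  shows "indep_in V B" "\<And>e. e \<notin> B \<Longrightarrow> \<not> indep_in V (insert e B)"
  using assms base_in_dependent[OF prim.subspace] by (auto simp: base_in_def)

lemma dual_base:
  assumes "base_in V B"
  shows "indep_in (orthogonal_comp V) (- B)"
    "\<And>e. e \<notin> - B \<Longrightarrow> \<not> indep_in (orthogonal_comp V) (insert e (- B))"
  using assms base_in_dependent[OF dual.subspace, of "- B"] base_in_compl[OF prim.subspace]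
  by (auto simp: base_in_def)

lemma orient_compatible:
  assumes B: "base_in V B"
  shows "orient B \<in> compatible_in V \<sigma> \<sigma>'"
proof -
  have "signature_compatible V \<sigma> (orient B)"
    by (rule prim.signature_compatible_of_fund_signs[OF prim_base[OF B]]) (auto simp: fund_orientation_def)
  moreover have "signature_compatible (orthogonal_comp V) \<sigma>' (orient B)"
    by (rule dual.signature_compatible_of_fund_signs[OF dual_base[OF B]]) (auto simp: fund_orientation_def)
  moreover have "is_orientation (orient B)"
    unfolding is_orientation_def fund_orientation_def
    using prim.fund_circuit_entry[OF prim_base[OF B]] dual.fund_circuit_entry[OF dual_base[OF B]]
    by auto
  ultimately show ?thesis by (simp add: compatible_in_def)
qed

lemma inner_coset:
  assumes "x - w \<in> V" "y \<in> orthogonal_comp V"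
  shows "w \<bullet> y = x \<bullet> y"
  using orthogonal_compD[OF assms] by (simp add: inner_diff_left)

text \<open>
  The inner product of \<open>x\<close> with the chosen fundamental cocircuit of \<open>e\<close> reduces to the term at
  \<open>e\<close>. It is positive because \<open>x\<close> and \<open>w\<close> differ by a vector orthogonal to that cocircuit.
\<close>
lemma basic_solution_sign:
  assumes B: "base_in V B" and x: "x - w \<in> V" "supp x \<subseteq> B" and e: "e \<in> B"
  shows "0 < orient B e * x $ e"
proof -
  let ?y = "\<sigma>' (fund (orthogonal_comp V) (- B) e)"
  have e': "e \<notin> - B" using e by simp
  note C = dual.fund_circuit(1)[OF dual_base(1)[OF B] dual_base(2)[OF B e']]
  have "0 < w \<bullet> ?y" by (rule dual.sig_pos[OF C])
  also have "w \<bullet> ?y = x \<bullet> ?y" by (rule inner_coset[OF x(1) dual.sig_mem[OF C]])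
  also have "x \<bullet> ?y = x $ e * ?y $ e"
    using x(2) dual.fund_circuit_other[OF dual_base(1)[OF B] dual_base(2)[OF B e']]
    by (intro inner_single) (auto simp: supp_def)
  finally show ?thesis using e by (simp add: fund_orientation_def mult.commute)
qed

lemma basic_solution_exists:
  assumes B: "base_in V B"
  obtains x where "x - w \<in> V" "supp x \<subseteq> B"
proof -
  obtain k where k: "k \<in> V" "\<And>e. e \<notin> B \<Longrightarrow> k $ e = w $ e"
    using coordinate_extension[OF prim.subspace dual_base(1)[OF B]] by blast
  show thesis
  proof (rule that[of "w - k"])
    show "w - k - w \<in> V" using subspace_neg[OF prim.subspace k(1)] by simp
    show "supp (w - k) \<subseteq> B" using k(2) by (fastforce simp: supp_def)
  qed
qed

text \<open>
  The basic solution \<open>x\<close> vanishes outside \<open>B\<close>, so there \<open>z - x\<close> has the signs of the chosen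
  fundamental circuits.
\<close>
lemma basic_solution_optimal:
  assumes B: "base_in V B" and x: "x - w \<in> V" "supp x \<subseteq> B"
    and z: "z - w \<in> V" "\<And>e. 0 \<le> orient B e * z $ e" and "z \<noteq> x"
  shows "p \<bullet> x < p \<bullet> z"
proof -
  have "z - x \<in> V" using subspace_diff[OF prim.subspace z(1) x(1)] by simp
  moreover have "0 \<le> (z - x) $ e * \<sigma> (fund V B e) $ e" if "e \<notin> B" for e
  proof -
    have "x $ e = 0" using that x(2) by (auto simp: supp_def)
    then show ?thesis using that z(2)[of e] by (simp add: fund_orientation_def mult.commute)
  qed
  ultimately have "0 < p \<bullet> (z - x)"
    using \<open>z \<noteq> x\<close> by (intro prim.inner_pos_of_fund_signs[OF prim_base[OF B]]) auto
  then show ?thesis by (simp add: inner_diff_right)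
qed

text \<open>
  The basic solutions of two bases with the same orientation are both the unique minimiser of
  one linear program, so they coincide, and each has its whole basis as support.
\<close>
lemma orient_inj: "inj_on orient {B. base_in V B}"
proof (rule inj_onI)
  fix B B' assume "B \<in> {B. base_in V B}" "B' \<in> {B. base_in V B}" and eq: "orient B = orient B'"
  then have B: "base_in V B" and B': "base_in V B'" by auto
  obtain x where x: "x - w \<in> V" "supp x \<subseteq> B" using basic_solution_exists[OF B] .
  obtain x' where x': "x' - w \<in> V" "supp x' \<subseteq> B'" using basic_solution_exists[OF B'] .
  have full: "supp x = B" "supp x' = B'"
    using basic_solution_sign[OF B x] basic_solution_sign[OF B' x'] x x'
    by (force simp: supp_def)+
  have feas: "0 \<le> orient B e * x $ e" "0 \<le> orient B' e * x' $ e" for e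
    using basic_solution_sign[OF B x, of e] basic_solution_sign[OF B' x', of e] x x'
    by (cases "x $ e = 0"; cases "x' $ e = 0"; force simp: supp_def)+
  have "x = x'"
  proof (rule ccontr)
    assume "x \<noteq> x'"
    then have "p \<bullet> x < p \<bullet> x'" "p \<bullet> x' < p \<bullet> x"
      using basic_solution_optimal[OF B x x'(1)] basic_solution_optimal[OF B' x' x(1)] feas eq
      by auto
    then show False by simp
  qed
  then show "B = B'" using full by simp
qed

text \<open>
  Nondegeneracy: a cocircuit disjoint from the support of \<open>x\<close> would be orthogonal to \<open>x\<close> and
  hence to \<open>w\<close>.
\<close>
lemma independent_support_base:
  assumes x: "x - w \<in> V" and indep: "indep_in V (supp x)"
  shows "base_in V (supp x)"
proof -
  have "indep_in (orthogonal_comp V) (- supp x)"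
  proof (rule ccontr)
    assume "\<not> indep_in (orthogonal_comp V) (- supp x)"
    then obtain C where C: "C \<in> circuits_in (orthogonal_comp V)" "C \<subseteq> - supp x"
      using dependent_contains_circuit by blast
    have "0 < x \<bullet> \<sigma>' C"
      using dual.sig_pos[OF C(1)] inner_coset[OF x dual.sig_mem[OF C(1)]] by simp
    moreover have "x $ e * \<sigma>' C $ e = 0" for e
      using C(2) dual.sig_nonzero_iff[OF C(1), of e] by (auto simp: supp_def)
    then have "x \<bullet> \<sigma>' C = 0" unfolding inner_vec_def inner_real_def by (rule sum.neutral[OF ballI])
    ultimately show False by simp
  qed
  then show ?thesis using indep by (simp add: base_in_def)
qed

text \<open>
  Farkas' lemma: if \<open>w\<close> is outside the closed cone \<open>V + P\<close>, where \<open>P\<close> is the orthant of \<open>Or\<close>, then a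
  separating vector \<open>y\<close> lies in the orthogonal complement of \<open>V\<close>, has the signs of \<open>Or\<close> and
  satisfies \<open>w \<bullet> y < 0\<close>. But \<open>y\<close> is composed of signed cocircuits compatible with \<open>Or\<close>, on which
  \<open>w\<close> is positive.
\<close>
lemma feasible_exists:
  assumes Or: "Or \<in> compatible_in V \<sigma> \<sigma>'"
  obtains x where "x - w \<in> V" "\<And>e. 0 \<le> Or e * x $ e"
proof -
  obtain S where S: "finite S" "span S = V"
    using orthonormal_basis_subspace[OF prim.subspace] by (metis finiteI_independent)
  define T where "T = convex_cone hull (S \<union> uminus ` S \<union> range (\<lambda>e. Or e *\<^sub>R axis e 1))"
  define P where "P = {x :: real ^ 'e. \<forall>e. 0 \<le> Or e * x $ e}"
  have SV: "s \<in> V" if "s \<in> S" for s using that S(2) span_base by blast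
  have "w \<in> T"
  proof (rule ccontr)
    assume "w \<notin> T"
    have "closed T" unfolding T_def by (rule closed_convex_cone_hull) (simp add: S(1))
    have "convex T" unfolding T_def by (rule convex_convex_cone_hull)
    from separating_hyperplane_closed_point[OF this \<open>closed T\<close> \<open>w \<notin> T\<close>]
    obtain y b where yw: "y \<bullet> w < b" and yT: "\<forall>t \<in> T. b < y \<bullet> t" by auto
    have b: "b < 0" using bspec[OF yT, of 0] by (simp add: T_def convex_cone_hull_contains_0)
    have nonneg: "0 \<le> y \<bullet> t" if t: "t \<in> T" for t
    proof (rule ccontr)
      assume "\<not> 0 \<le> y \<bullet> t"
      then have neg: "y \<bullet> t < 0" by simp
      \<comment> \<open>This multiple of \<open>t\<close> lies on the separating hyperplane itself.\<close>
      then have "(b / (y \<bullet> t)) *\<^sub>R t \<in> T"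
        using t b unfolding T_def by (intro convex_cone_hull_mul) (auto simp: divide_nonpos_neg)
      then show False using yT neg by fastforce
    qed
    have yS: "y \<bullet> s = 0" if "s \<in> S" for s
    proof -
      have "s \<in> T" "- s \<in> T" using that unfolding T_def by (auto intro!: hull_inc)
      then show ?thesis using nonneg[of s] nonneg[of "- s"] by simp
    qed
    have "y \<bullet> v = 0" if "v \<in> span S" for v
      using that by (induction rule: span_induct) (use yS in \<open>auto simp: subspace_hyperplane\<close>)
    then have yW: "y \<in> orthogonal_comp V"
      using S(2) by (auto simp: orthogonal_comp_def orthogonal_def inner_commute)
    have "Or e *\<^sub>R axis e 1 \<in> T" for e unfolding T_def by (auto intro!: hull_inc)
    then have sgn: "0 \<le> Or e * y $ e" for e using nonneg[of "Or e *\<^sub>R axis e 1"] by (simp add: inner_axis)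
    have "0 < w \<bullet> d" if d: "d \<in> signed_in (orthogonal_comp V)" "conformal d y" for d
    proof -
      have "compatible Or d"
        unfolding compatible_def
      proof
        fix e assume e: "e \<in> supp d"
        have "0 < d $ e * y $ e" using d(2) e by (simp add: conformal_def supp_def)
        moreover have "Or e = 1 \<or> Or e = -1" "d $ e = 1 \<or> d $ e = -1"
          using Or d(1) e by (auto simp: compatible_in_def is_orientation_def signed_in_def supp_def)
        ultimately show "Or e = d $ e" using sgn[of e] by auto
      qed
      then have "d = \<sigma>' (supp d)"
        using Or d(1) by (intro dual.signature_compatible_sig) (auto simp: compatible_in_def)
      then show ?thesis using dual.sig_pos[of "supp d"] d(1) by (simp add: signed_in_def)
    qed
    moreover have "y \<noteq> 0" using yw b by auto
    ultimately have "0 < w \<bullet> y" using dual.positive_if_conformal_positive[OF yW] by blast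
    then show False using yw b by (simp add: inner_commute)
  qed
  moreover have "T \<subseteq> (\<Union>k\<in>V. \<Union>x\<in>P. {k + x})"
    unfolding T_def
  proof (rule hull_minimal)
    have P: "convex_cone P"
      unfolding convex_cone_iff P_def
      by (auto simp: distrib_left mult.left_commute[of "Or _"])
    then show "convex_cone (\<Union>k\<in>V. \<Union>x\<in>P. {k + x})"
      using subspace_imp_convex_cone[OF prim.subspace] by (rule convex_cone_sums[rotated])
    have "\<exists>k\<in>V. \<exists>x\<in>P. t = k + x" if "t \<in> S \<union> uminus ` S" for t
      using that SV subspace_neg[OF prim.subspace] convex_cone_contains_0[OF P]
      by (intro bexI[of _ t] bexI[of _ 0]) auto
    moreover have "\<exists>k\<in>V. \<exists>x\<in>P. Or e *\<^sub>R axis e 1 = k + x" for e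
      using subspace_0[OF prim.subspace]
      by (intro bexI[of _ 0] bexI[of _ "Or e *\<^sub>R axis e 1"]) (auto simp: P_def axis_def)
    ultimately show "S \<union> uminus ` S \<union> range (\<lambda>e. Or e *\<^sub>R axis e 1) \<subseteq> (\<Union>k\<in>V. \<Union>x\<in>P. {k + x})"
      by fastforce
  qed
  ultimately obtain k x where kx: "k \<in> V" "x \<in> P" "w = k + x" by blast
  then have "x - w \<in> V" using subspace_neg[OF prim.subspace kx(1)] by simp
  then show thesis using that kx(2) by (auto simp: P_def)
qed

definition vertices :: "('e \<Rightarrow> real) \<Rightarrow> (real ^ 'e) set" where
  "vertices Or = {x. x - w \<in> V \<and> (\<forall>e. 0 \<le> Or e * x $ e) \<and> indep_in V (supp x)}"

lemma finite_vertices: "finite (vertices Or)"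
proof (rule finite_imageD)
  show "inj_on supp (vertices Or)"
  proof (rule inj_onI)
    fix x y assume x: "x \<in> vertices Or" and y: "y \<in> vertices Or" and eq: "supp x = supp y"
    have "x - y \<in> V"
      using subspace_diff[OF prim.subspace, of "x - w" "y - w"] x y by (simp add: vertices_def)
    moreover have "supp (x - y) \<subseteq> supp x" using eq by (auto simp: supp_def set_eq_iff)
    ultimately have "x - y = 0" using x unfolding vertices_def indep_in_def by blast
    then show "x = y" by simp
  qed
qed simp

text \<open>
  A feasible point of smallest support is a vertex: along a vector of \<open>V\<close> inside its support one
  could move until another coordinate vanishes.
\<close>
lemma vertices_nonempty:
  assumes Or: "Or \<in> compatible_in V \<sigma> \<sigma>'"
  shows "vertices Or \<noteq> {}"
proof -
  have Or1: "Or e = 1 \<or> Or e = -1" for e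
    using Or by (auto simp: compatible_in_def is_orientation_def)
  let ?F = "\<lambda>x. x - w \<in> V \<and> (\<forall>e. 0 \<le> Or e * x $ e)"
  have "\<exists>x. ?F x" using feasible_exists[OF Or] by metis
  then obtain x where x: "?F x" and least: "\<And>y. ?F y \<Longrightarrow> card (supp x) \<le> card (supp y)"
    using exists_least_iff[of "\<lambda>n. \<exists>x. ?F x \<and> card (supp x) = n"] by (metis not_less)
  have "indep_in V (supp x)"
  proof (rule ccontr)
    assume "\<not> indep_in V (supp x)"
    then obtain k where k: "k \<in> V" "supp k \<subseteq> supp x" "k \<noteq> 0" by (auto simp: indep_in_def)
    obtain d e where d: "d \<in> V" "supp d \<subseteq> supp x" "Or e * d $ e < 0"
    proof -
      obtain e where e: "k $ e \<noteq> 0" using k(3) by (auto simp: vec_eq_iff)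
      have "Or e * k $ e < 0 \<or> Or e * (- k) $ e < 0" using e Or1[of e] by auto
      moreover have "- k \<in> V" "supp (- k) \<subseteq> supp x"
        using subspace_neg[OF prim.subspace k(1)] k(2) by (auto simp: supp_def)
      ultimately show thesis using that k by blast
    qed
    have "0 < Or f * x $ f" if f: "Or f * d $ f < 0" for f
    proof -
      have "d $ f \<noteq> 0" using f by auto
      then have "x $ f \<noteq> 0" using d(2) by (auto simp: supp_def)
      then have "Or f * x $ f \<noteq> 0" using Or1[of f] by auto
      then show ?thesis using x by (simp add: order_less_le)
    qed
    then obtain l f where l: "0 < l" "\<And>e. 0 \<le> Or e * (x + l *\<^sub>R d) $ e"
      "Or f * d $ f < 0" "(x + l *\<^sub>R d) $ f = 0"
      using ratio_test[of Or x d] x d(3) by blast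
    have "x + l *\<^sub>R d - w = (x - w) + l *\<^sub>R d" by simp
    also have "\<dots> \<in> V" using x d(1) prim.subspace by (simp add: subspace_add subspace_scale)
    finally have "?F (x + l *\<^sub>R d)" using l(2) by simp
    moreover have "supp (x + l *\<^sub>R d) \<subset> supp x"
    proof
      show "supp (x + l *\<^sub>R d) \<subseteq> supp x" using d(2) by (auto simp: supp_def)
      have "d $ f \<noteq> 0" using l(3) by auto
      then have "f \<in> supp x" using d(2) by (auto simp: supp_def)
      moreover have "f \<notin> supp (x + l *\<^sub>R d)" using l(4) by (simp only: supp_def) simp
      ultimately show "supp (x + l *\<^sub>R d) \<noteq> supp x" by blast
    qed
    then have "card (supp (x + l *\<^sub>R d)) < card (supp x)" by (simp add: psubset_card_mono)
    ultimately show False using least[of "x + l *\<^sub>R d"] by simp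
  qed
  then show ?thesis using x by (auto simp: vertices_def)
qed

text \<open>
  The exchange step of a pivot: \<open>e\<close> enters and \<open>f\<close> leaves the basis.
\<close>
lemma pivot_independent:
  assumes B: "indep_in V B" and d: "d \<in> V" "supp d \<subseteq> insert e B" "d $ e \<noteq> 0"
    and f: "d $ f \<noteq> 0" and S: "S \<subseteq> insert e B - {f}"
  shows "indep_in V S"
  unfolding indep_in_def
proof (intro ballI impI)
  fix k assume k: "k \<in> V" "supp k \<subseteq> S"
  define c where "c = k $ e / d $ e"
  have "k - c *\<^sub>R d \<in> V" using k(1) d(1) prim.subspace by (simp add: subspace_diff subspace_scale)
  moreover have "(k - c *\<^sub>R d) $ g = 0" if "g \<notin> B" for g
  proof (cases "g = e")
    case False
    then have "g \<notin> supp k" "g \<notin> supp d" using that k(2) S d(2) by auto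
    then show ?thesis by (simp add: supp_def)
  qed (use d(3) in \<open>simp add: c_def\<close>)
  then have "supp (k - c *\<^sub>R d) \<subseteq> B" by (auto simp: supp_def)
  ultimately have "k - c *\<^sub>R d = 0" using B unfolding indep_in_def by blast
  then have eq: "k = c *\<^sub>R d" by simp
  have "k $ f = 0" using k(2) S by (auto simp: supp_def)
  then have "c = 0" using f by (simp add: eq)
  then show "k = 0" using eq by simp
qed

text \<open>
  If the orientation of the optimal basis disagreed with \<open>Or\<close> at some \<open>e\<close> outside it, then the
  negative \<open>d\<close> of the chosen fundamental circuit of \<open>e\<close> would be an improving direction. As \<open>d\<close> is
  not compatible with \<open>Or\<close>, some coordinate blocks it, and the ratio test ends in a
  better vertex.
\<close>
lemma optimal_vertex_orient:
  assumes Or: "Or \<in> compatible_in V \<sigma> \<sigma>'"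
    and x: "x \<in> vertices Or" and least: "\<And>y. y \<in> vertices Or \<Longrightarrow> p \<bullet> x \<le> p \<bullet> y"
  shows "base_in V (supp x)" "orient (supp x) = Or"
proof -
  have xw: "x - w \<in> V" and feas: "\<And>e. 0 \<le> Or e * x $ e" and indep: "indep_in V (supp x)"
    using x by (auto simp: vertices_def)
  show B: "base_in V (supp x)" by (rule independent_support_base[OF xw indep])
  have Or1: "Or e = 1 \<or> Or e = -1" for e
    using Or by (auto simp: compatible_in_def is_orientation_def)
  have or1: "orient (supp x) e = 1 \<or> orient (supp x) e = -1" for e
    using orient_compatible[OF B] by (auto simp: compatible_in_def is_orientation_def)
  show "orient (supp x) = Or"
  proof
    fix e
    show "orient (supp x) e = Or e"
    proof (cases "e \<in> supp x")
      case True
      then show ?thesis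
        using basic_solution_sign[OF B xw _ True] feas[of e] Or1[of e] or1[of e] by auto
    next
      case False
      define C where "C = fund V (supp x) e"
      note C = prim.fund_circuit[OF prim_base(1)[OF B] prim_base(2)[OF B False], folded C_def]
      define d where "d = - \<sigma> C"
      show ?thesis
      proof (rule ccontr)
        assume "orient (supp x) e \<noteq> Or e"
        then have de: "d $ e = Or e"
          using False Or1[of e] or1[of e] by (auto simp: fund_orientation_def d_def C_def)
        have dV: "d \<in> signed_in V"
          unfolding d_def by (rule prim.uminus_signed[OF prim.sig_signed[OF C(1)]])
        have sd: "supp d = C" using prim.sig_supp[OF C(1)] by (simp add: d_def supp_def)
        have pd: "p \<bullet> d < 0" using prim.sig_pos[OF C(1)] by (simp add: d_def)
        have "\<exists>f. Or f * d $ f < 0"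
        proof (rule ccontr)
          assume no: "\<nexists>f. Or f * d $ f < 0"
          have "compatible Or d"
            unfolding compatible_def
          proof
            fix f assume "f \<in> supp d"
            then have "d $ f = 1 \<or> d $ f = -1" using dV by (auto simp: signed_in_def supp_def)
            moreover have "\<not> Or f * d $ f < 0" using no by blast
            ultimately show "Or f = d $ f" using Or1[of f] by auto
          qed
          then have "d = \<sigma> C"
            using prim.signature_compatible_sig[of Or d] Or dV sd by (auto simp: compatible_in_def)
          then show False using pd prim.sig_pos[OF C(1)] by simp
        qed
        moreover have "0 < Or f * x $ f" if f: "Or f * d $ f < 0" for f
        proof -
          have "f \<noteq> e" using f de Or1[of e] by auto
          moreover have "f \<in> C" using f sd by (auto simp: supp_def)
          ultimately have "x $ f \<noteq> 0" using C(2) by (auto simp: supp_def)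
          then have "Or f * x $ f \<noteq> 0" using Or1[of f] by auto
          then show ?thesis using feas[of f] by (simp add: order_less_le)
        qed
        ultimately obtain l f where l: "0 < l" "\<And>e. 0 \<le> Or e * (x + l *\<^sub>R d) $ e"
          "Or f * d $ f < 0" "(x + l *\<^sub>R d) $ f = 0"
          using ratio_test[of Or x d] feas by blast
        have dV': "d \<in> V" using dV by (simp add: signed_in_def)
        have "x + l *\<^sub>R d - w = (x - w) + l *\<^sub>R d" by simp
        also have "\<dots> \<in> V" using xw dV' prim.subspace by (simp add: subspace_add subspace_scale)
        finally have "x + l *\<^sub>R d - w \<in> V" .
        moreover have "indep_in V (supp (x + l *\<^sub>R d))"
        proof (rule pivot_independent[OF indep dV'])
          show "supp d \<subseteq> insert e (supp x)" using sd C(2) by simp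
          show "d $ e \<noteq> 0" using de Or1[of e] by auto
          show "d $ f \<noteq> 0" using l(3) by auto
          have "supp (x + l *\<^sub>R d) \<subseteq> supp x \<union> supp d" by (auto simp: supp_def)
          moreover have "f \<notin> supp (x + l *\<^sub>R d)" using l(4) by (simp only: supp_def) simp
          ultimately show "supp (x + l *\<^sub>R d) \<subseteq> insert e (supp x) - {f}" using sd C(2) by blast
        qed
        ultimately have "x + l *\<^sub>R d \<in> vertices Or" using l(2) by (simp add: vertices_def)
        from least[OF this] have "0 \<le> l * (p \<bullet> d)" by (simp add: inner_add_right)
        moreover have "l * (p \<bullet> d) < 0" using l(1) pd by (simp add: mult_pos_neg)
        ultimately show False by simp
      qed
    qed
  qed
qed

lemma orient_bij:
  "bij_betw orient {B. base_in V B} (compatible_in V \<sigma> \<sigma>')"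
  unfolding bij_betw_def
proof
  show "inj_on orient {B. base_in V B}" by (rule orient_inj)
  show "orient ` {B. base_in V B} = compatible_in V \<sigma> \<sigma>'"
  proof
    show "orient ` {B. base_in V B} \<subseteq> compatible_in V \<sigma> \<sigma>'"
      using orient_compatible by blast
    show "compatible_in V \<sigma> \<sigma>' \<subseteq> orient ` {B. base_in V B}"
    proof
      fix Or assume Or: "Or \<in> compatible_in V \<sigma> \<sigma>'"
      let ?m = "Min ((\<bullet>) p ` vertices Or)"
      have fin: "finite ((\<bullet>) p ` vertices Or)" using finite_vertices by simp
      have "?m \<in> (\<bullet>) p ` vertices Or" using fin vertices_nonempty[OF Or] by (intro Min_in) auto
      then obtain x where x: "x \<in> vertices Or" "p \<bullet> x = ?m" by auto
      have "p \<bullet> x \<le> p \<bullet> y" if "y \<in> vertices Or" for y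
        unfolding x(2) using fin that by (intro Min_le) auto
      from optimal_vertex_orient[OF Or x(1) this]
      show "Or \<in> orient ` {B. base_in V B}" by (metis (mono_tags) image_eqI mem_Collect_eq)
    qed
  qed
qed

end


section \<open>The kernel and the row space of a matrix\<close>

definition kernel :: "real ^ 'e ^ 'r \<Rightarrow> (real ^ 'e) set" where
  "kernel A = {x. A *v x = 0}"

lemma subspace_kernel: "subspace (kernel A)"
  by (auto simp: subspace_def kernel_def matrix_vector_right_distrib matrix_vector_mult_scaleR)

lemma subspace_row_space: "subspace (row_space A)"
  by (simp add: row_space_def)

lemma orthogonal_comp_row_space: "orthogonal_comp (row_space A) = kernel A"
proof
  show "kernel A \<subseteq> orthogonal_comp (row_space A)"
    using orthogonal_nullspace_rowspace
    by (auto simp: kernel_def row_space_def orthogonal_comp_def orthogonal_commute)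
  show "orthogonal_comp (row_space A) \<subseteq> kernel A"
  proof
    fix x assume x: "x \<in> orthogonal_comp (row_space A)"
    have "(A *v x) $ i = 0" for i
    proof -
      have "row i A \<in> row_space A" by (auto simp: row_space_def rows_def intro!: span_base)
      then have "row i A \<bullet> x = 0" using x orthogonal_compD by blast
      then show ?thesis by (simp add: matrix_vector_mul_component row_def)
    qed
    then show "x \<in> kernel A" by (simp add: kernel_def vec_eq_iff)
  qed
qed

lemma orthogonal_comp_kernel: "orthogonal_comp (kernel A) = row_space A"
  using orthogonal_comp_self[OF subspace_row_space] orthogonal_comp_row_space by metis

lemma matrix_mult_columns:
  assumes "supp x \<subseteq> S"
  shows "A *v x = (\<Sum>e \<in> S. x $ e *\<^sub>R column e A)"
  unfolding matrix_mult_sum scalar_mult_eq_scaleR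
  using assms by (intro sum.mono_neutral_right) (auto simp: supp_def)

lemma col_indep_iff: "col_indep A I \<longleftrightarrow> indep_in (kernel A) I"
proof
  assume I: "col_indep A I"
  then have inj: "inj_on (\<lambda>e. column e A) I" by (simp add: col_indep_def)
  show "indep_in (kernel A) I"
    unfolding indep_in_def
  proof (intro ballI impI)
    fix x assume "x \<in> kernel A" and x: "supp x \<subseteq> I"
    then have "0 = (\<Sum>e \<in> I. x $ e *\<^sub>R column e A)"
      using matrix_mult_columns[OF x, of A] by (simp add: kernel_def)
    also have "\<dots> = (\<Sum>v \<in> (\<lambda>e. column e A) ` I. x $ the_inv_into I (\<lambda>e. column e A) v *\<^sub>R v)"
      by (simp add: sum.reindex[OF inj] the_inv_into_f_f[OF inj])
    finally have z: "(\<Sum>v \<in> (\<lambda>e. column e A) ` I. x $ the_inv_into I (\<lambda>e. column e A) v *\<^sub>R v) = 0"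
      by simp
    have "x $ e = 0" if e: "e \<in> I" for e
      using independentD[OF _ _ subset_refl z, of "column e A"] I e
      by (simp add: col_indep_def the_inv_into_f_f[OF inj])
    then show "x = 0" using x by (auto simp: vec_eq_iff supp_def)
  qed
next
  assume I: "indep_in (kernel A) I"
  have inj: "inj_on (\<lambda>e. column e A) I"
  proof (rule inj_onI, rule ccontr)
    fix e f assume ef: "e \<in> I" "f \<in> I" "column e A = column f A" "e \<noteq> f"
    have "axis e 1 - axis f 1 \<in> kernel A"
      using ef(3) by (simp add: kernel_def matrix_vector_mult_diff_distrib matrix_vector_mult_basis)
    moreover have "supp (axis e 1 - axis f 1 :: real ^ _) \<subseteq> I"
      using ef by (auto simp: supp_def axis_def split: if_splits)
    ultimately have "axis e 1 - axis f 1 = (0 :: real ^ _)" using I unfolding indep_in_def by blast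
    then have "(axis e 1 - axis f 1 :: real ^ _) $ e = 0" by simp
    then show False using ef(4) by (simp add: axis_def)
  qed
  have "u v = 0" if z: "(\<Sum>v \<in> (\<lambda>e. column e A) ` I. u v *\<^sub>R v) = 0"
    and v: "v \<in> (\<lambda>e. column e A) ` I" for u v
  proof -
    define x where "x = (\<chi> e. if e \<in> I then u (column e A) else 0)"
    have x: "supp x \<subseteq> I" by (auto simp: supp_def x_def)
    have "A *v x = (\<Sum>e \<in> I. u (column e A) *\<^sub>R column e A)"
      unfolding matrix_mult_columns[OF x] by (simp add: x_def)
    also have "\<dots> = 0" using z by (simp add: sum.reindex[OF inj])
    finally have "x = 0" using I x by (simp add: indep_in_def kernel_def)
    moreover obtain e where e: "e \<in> I" "v = column e A" using v by blast
    ultimately have "x $ e = 0" by simp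
    then show ?thesis using e by (simp add: x_def)
  qed
  then have "independent ((\<lambda>e. column e A) ` I)"
    by (subst dependent_finite) auto
  then show "col_indep A I" using inj by (simp add: col_indep_def)
qed

lemma col_indep_eq: "col_indep A = indep_in (kernel A)"
  by (auto simp: col_indep_iff)

lemma circuits_eq: "circuits A = circuits_in (kernel A)"
  by (simp add: circuits_def col_indep_eq)

lemma cocircuits_eq: "cocircuits A = circuits_in (row_space A)"
  by (simp add: cocircuits_def col_indep_eq dual_indep_in[OF subspace_kernel] orthogonal_comp_kernel)

lemma bases_eq: "bases A = {B. base_in (kernel A) B}"
  by (auto simp: bases_def col_indep_eq bases_of_indep_in[OF subspace_kernel])

lemma signed_circuits_eq: "signed_circuits A = signed_in (kernel A)"
  by (auto simp: signed_circuits_def signed_in_def circuits_eq kernel_def)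

lemma signed_cocircuits_eq: "signed_cocircuits A = signed_in (row_space A)"
  by (auto simp: signed_cocircuits_def signed_in_def cocircuits_eq)

lemma beta_hat_eq: "beta_hat A \<sigma> \<sigma>' = fund_orientation (kernel A) \<sigma> \<sigma>'"
  by (auto simp: fun_eq_iff beta_hat_def fund_orientation_def fund_circuit_def fund_cocircuit_def
      fund_def circuits_eq cocircuits_eq orthogonal_comp_kernel)

lemma compatible_orientations_eq:
  "compatible_orientations A \<sigma> \<sigma>' = compatible_in (kernel A) \<sigma> \<sigma>'"
  by (simp add: compatible_orientations_def compatible_in_def signature_compatible_def
      signed_circuits_eq signed_cocircuits_eq circuits_eq cocircuits_eq orthogonal_comp_kernel)

section \<open>Total unimodularity and integral coordinates\<close>

text \<open>
  Conjugation with the enumeration \<open>f\<close> of the rows turns permutations of \<open>{..<k}\<close> into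
  permutations of the index type and preserves signs.
\<close>
lemma submatrix_det_eq_det:
  fixes A :: "real ^ 'e ^ 'r::finite"
  assumes f: "bij_betw f {..<k} (UNIV :: 'r set)"
  shows "submatrix_det A k f g = det (\<chi> i j. A $ i $ g (the_inv_into {..<k} f j))"
proof -
  let ?h = "the_inv_into {..<k} f"
  let ?P = "map_permutation {..<k} f" and ?Q = "map_permutation UNIV ?h"
  have inj: "inj_on f {..<k}" using f by (simp add: bij_betw_def)
  have h: "bij_betw ?h UNIV {..<k}" by (rule bij_betw_the_inv_into[OF f])
  have hf: "?h (f i) = i" if "i < k" for i using the_inv_into_f_f[OF inj] that by simp
  have fh: "f (?h j) = j" for j using f by (simp add: f_the_inv_into_f_bij_betw)
  have "submatrix_det A k f g =
      (\<Sum>q | q permutes (UNIV :: 'r set). of_int (sign q) * (\<Prod>i \<in> UNIV. A $ i $ g (?h (q i))))"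
    unfolding submatrix_det_def
  proof (rule sum.reindex_bij_witness[where i = ?Q and j = ?P])
    fix p assume "p \<in> {p. p permutes {..<k}}"
    then have p: "p permutes {..<k}" by simp
    show "?Q (?P p) = p" by (rule map_permutation_compose_inv[OF f p]) (simp add: hf)
    have P: "?P p permutes UNIV" by (rule map_permutation_permutes[OF f p])
    then show "?P p \<in> {q. q permutes UNIV}" by simp
    have "(\<Prod>i \<in> UNIV. A $ i $ g (?h (?P p i))) = (\<Prod>i<k. A $ f i $ g (?h (?P p (f i))))"
      by (rule prod.reindex_bij_betw[OF f, symmetric])
    also have "\<dots> = (\<Prod>i<k. A $ f i $ g (p i))"
    proof (rule prod.cong[OF refl])
      fix i assume i: "i \<in> {..<k}"
      then have "p i < k" using permutes_in_image[OF p, of i] by simp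
      then show "A $ f i $ g (?h (?P p (f i))) = A $ f i $ g (p i)"
        using i by (simp add: map_permutation_apply[OF inj] hf)
    qed
    finally show "of_int (sign (?P p)) * (\<Prod>i \<in> UNIV. A $ i $ g (?h (?P p i))) =
        of_int (sign p) * (\<Prod>i<k. A $ f i $ g (p i))"
      by (simp add: sign_map_permutation[OF inj p])
  next
    fix q assume "q \<in> {q. q permutes (UNIV :: 'r set)}"
    then have q: "q permutes UNIV" by simp
    show "?P (?Q q) = q" by (rule map_permutation_compose_inv[OF h q]) (simp add: fh)
    show "?Q q \<in> {p. p permutes {..<k}}" using map_permutation_permutes[OF h q] by simp
  qed
  then show ?thesis by (simp add: det_def)
qed

lemma totally_unimodular_entry:
  assumes "totally_unimodular A"
  shows "A $ i $ e \<in> \<int>"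
proof -
  have "submatrix_det A 1 (\<lambda>_. i) (\<lambda>_. e) \<in> {-1, 0, 1}"
    using assms[unfolded totally_unimodular_def, rule_format, of "\<lambda>_. i" 1 "\<lambda>_. e"]
    by (simp add: lessThan_Suc)
  moreover have "{p. p permutes {..<1::nat}} = {id}"
    by (auto simp: lessThan_Suc permutes_sing)
  then have "submatrix_det A 1 (\<lambda>_. i) (\<lambda>_. e) = A $ i $ e"
    by (simp add: submatrix_det_def)
  ultimately show ?thesis by auto
qed

lemma det_Ints:
  fixes M :: "real ^ 'n ^ 'n::finite"
  assumes "\<And>i j. M $ i $ j \<in> \<int>"
  shows "det M \<in> \<int>"
  unfolding det_def using assms by (intro Ints_sum Ints_mult Ints_prod) auto

lemma base_spans:
  fixes A :: "real ^ 'e::finite ^ 'r::finite"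
  assumes rank: "rank A = CARD('r)" and B: "base_in (kernel A) B"
  obtains x where "supp x \<subseteq> B" "A *v x = b"
proof -
  obtain z where z: "A *v z = b" using full_rank_surjective[of A] rank by (metis surjD)
  obtain k where k: "k \<in> kernel A" "\<And>e. e \<notin> B \<Longrightarrow> k $ e = z $ e"
    using coordinate_extension[OF subspace_kernel, of A B z] B by (auto simp: base_in_def)
  have "A *v (z - k) = b" using k(1) z by (simp add: kernel_def matrix_vector_mult_diff_distrib)
  moreover have "supp (z - k) \<subseteq> B" using k(2) by (fastforce simp: supp_def)
  ultimately show thesis using that by blast
qed

lemma card_base:
  fixes A :: "real ^ 'e::finite ^ 'r::finite"
  assumes rank: "rank A = CARD('r)" and B: "base_in (kernel A) B"
  shows "card B = CARD('r)"
proof -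
  let ?S = "(\<lambda>e. column e A) ` B"
  have ci: "col_indep A B" using B by (simp add: col_indep_eq base_in_def)
  then have "card B = card ?S" by (simp add: col_indep_def card_image)
  also have "\<dots> = dim (UNIV :: (real ^ 'r) set)"
  proof (rule basis_card_eq_dim)
    show "UNIV \<subseteq> span ?S"
    proof
      fix b :: "real ^ 'r"
      obtain x where "supp x \<subseteq> B" "A *v x = b" using base_spans[OF rank B] by blast
      then have "b = (\<Sum>e \<in> B. x $ e *\<^sub>R column e A)" using matrix_mult_columns by metis
      also have "\<dots> \<in> span ?S" by (intro span_sum span_scale span_base) auto
      finally show "b \<in> span ?S" .
    qed
    show "independent ?S" using ci by (simp add: col_indep_def)
  qed simp
  finally show ?thesis by simp
qed

text \<open>
  The columns of a basis form a square matrix of determinant \<open>1\<close> or \<open>-1\<close>, so Cramer's rule divides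
  an integral determinant by a unit.
\<close>
lemma integral_coordinates:
  fixes A :: "real ^ 'e::finite ^ 'r::finite"
  assumes tu: "totally_unimodular A" and rank: "rank A = CARD('r)"
    and B: "base_in (kernel A) B"
    and x: "supp x \<subseteq> B" and int: "\<And>i. (A *v x) $ i \<in> \<int>"
  shows "x $ e \<in> \<int>"
proof (cases "e \<in> B")
  case False
  then have "x $ e = 0" using x by (auto simp: supp_def)
  then show ?thesis by simp
next
  case True
  obtain f where f: "bij_betw f {..<CARD('r)} (UNIV :: 'r set)"
    using ex_bij_betw_nat_finite[of "UNIV :: 'r set"] by (auto simp: lessThan_atLeast0)
  obtain g where g: "bij_betw g {..<CARD('r)} B"
    using ex_bij_betw_nat_finite[of B] card_base[OF rank B] by (auto simp: lessThan_atLeast0)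
  define h where "h j = g (the_inv_into {..<CARD('r)} f j)" for j
  have h: "bij_betw h UNIV B"
    unfolding h_def using bij_betw_trans[OF bij_betw_the_inv_into[OF f] g] by (simp add: o_def)
  define M :: "real ^ 'r ^ 'r" where "M = (\<chi> i j. A $ i $ h j)"
  have Mv: "M *v (\<chi> j. y $ h j) = A *v y" if "supp y \<subseteq> B" for y
  proof -
    have "M *v (\<chi> j. y $ h j) = (\<Sum>j \<in> UNIV. y $ h j *\<^sub>R column (h j) A)"
      unfolding matrix_mult_sum scalar_mult_eq_scaleR
      by (intro sum.cong) (simp_all add: M_def column_def vec_eq_iff)
    also have "\<dots> = (\<Sum>e \<in> B. y $ e *\<^sub>R column e A)"
      by (rule sum.reindex_bij_betw[OF h])
    finally show ?thesis using matrix_mult_columns[OF that, of A] by simp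
  qed
  have "surj ((*v) M)"
  proof -
    have "\<exists>v. b = M *v v" for b
      using base_spans[OF rank B, of b] Mv by metis
    then show ?thesis by (simp add: surj_def)
  qed
  then have nz: "det M \<noteq> 0" using full_rank_surjective[of M] by (simp add: det_eq_0_rank)
  have "det M = submatrix_det A CARD('r) f g"
    unfolding submatrix_det_eq_det[OF f] M_def h_def ..
  also have "\<dots> \<in> {-1, 0, 1}"
    using tu f g unfolding totally_unimodular_def by (auto simp: bij_betw_def)
  finally have unit: "det M = 1 \<or> det M = -1" using nz by auto
  let ?N = "\<lambda>k. \<chi> i j. if j = k then (A *v x) $ i else M $ i $ j"
  have "(\<chi> j. x $ h j) = (\<chi> k. det (?N k) / det M)"
    using cramer[OF nz, of "\<chi> j. x $ h j" "A *v x"] Mv[OF x] by simp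
  then have "x $ h k = det (?N k) / det M" for k by (simp add: vec_eq_iff)
  moreover have "det (?N k) \<in> \<int>" for k
    using int totally_unimodular_entry[OF tu] by (intro det_Ints) (simp add: M_def)
  ultimately have "x $ h k \<in> \<int>" for k using unit by auto
  moreover obtain k where "e = h k" using True h by (auto simp: bij_betw_def)
  ultimately show ?thesis by simp
qed


section \<open>Shifted cells and their lattice point\<close>

definition indicator_vec :: "'e set \<Rightarrow> real ^ 'e" where
  "indicator_vec S = (\<chi> e. if e \<in> S then 1 else 0)"

lemma matrix_mult_indicator: "A *v indicator_vec S = (\<Sum>e \<in> S. column e A)"
proof -
  have "supp (indicator_vec S) \<subseteq> S" by (auto simp: supp_def indicator_vec_def)
  from matrix_mult_columns[OF this] show ?thesis by (simp add: indicator_vec_def)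
qed

lemma psi_eq: "psi A Or = A *v indicator_vec {e. Or e = 1}"
  by (simp add: psi_def matrix_mult_indicator)

lemma orth_proj_row_space:
  fixes A :: "real ^ 'e::finite ^ 'r::finite"
  shows "orth_proj (row_space A) x \<in> row_space A"
    and "A *v orth_proj (row_space A) x = A *v x"
proof -
  let ?V = "row_space A"
  have V: "subspace ?V" by (rule subspace_row_space)
  have "x \<in> ?V + orthogonal_comp ?V" using subspace_sum_orthogonal_comp[OF V] by simp
  then obtain v k where vk: "v \<in> ?V" "k \<in> kernel A" "x = v + k"
    unfolding orthogonal_comp_row_space by (auto elim: set_plus_elim)
  have "orth_proj ?V x = v"
    unfolding orth_proj_def
  proof (rule the_equality)
    show "v \<in> ?V \<and> (\<forall>u \<in> ?V. orthogonal (x - v) u)"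
      using vk unfolding orthogonal_comp_row_space[symmetric]
      by (auto simp: orthogonal_comp_def orthogonal_commute)
  next
    fix q assume q: "q \<in> ?V \<and> (\<forall>u \<in> ?V. orthogonal (x - q) u)"
    then have "x - q \<in> kernel A"
      unfolding orthogonal_comp_row_space[symmetric]
      by (auto simp: orthogonal_comp_def orthogonal_commute)
    then have "A *v q = A *v v"
      using vk by (simp add: kernel_def matrix_vector_mult_diff_distrib matrix_vector_right_distrib)
    then show "q = v"
      using q vk(1) matrix_vector_mul_injective_on_rowspace unfolding row_space_def by blast
  qed
  then show "orth_proj ?V x \<in> ?V" "A *v orth_proj ?V x = A *v x"
    using vk by (simp_all add: kernel_def matrix_vector_right_distrib)
qed

text \<open>
  The vertex of the cube that belongs to \<open>Or\<close>, projected into the row zonotope; multiplication by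
  \<open>A\<close> sends it to \<open>psi A Or\<close>.
\<close>
definition orientation_point :: "real ^ 'e ^ 'r \<Rightarrow> ('e \<Rightarrow> real) \<Rightarrow> real ^ 'e" where
  "orientation_point A Or = (\<Sum>e | Or e = 1. orth_proj (row_space A) (axis e 1))"

lemma orientation_point_row_space: "orientation_point A Or \<in> row_space A"
  unfolding orientation_point_def
  by (intro subspace_sum[OF subspace_row_space] orth_proj_row_space)

lemma matrix_mult_orientation_point: "A *v orientation_point A Or = psi A Or"
  by (simp add: orientation_point_def psi_def linear_sum[OF matrix_vector_mul_linear]
      orth_proj_row_space matrix_vector_mult_basis)

lemma orientation_point_row_zonotope:
  fixes A :: "real ^ 'e::finite ^ 'r::finite"
  shows "orientation_point A Or \<in> row_zonotope A"
proof -
  have "orientation_point A Or =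
      (\<Sum>e \<in> UNIV. (if Or e = 1 then 1 else 0) *\<^sub>R orth_proj (row_space A) (axis e 1))"
    unfolding orientation_point_def
    by (simp add: if_distrib[of "\<lambda>c. c *\<^sub>R _"] sum.If_cases cong: if_cong)
  then show ?thesis
    unfolding row_zonotope_def
    by (auto intro!: exI[of _ "\<lambda>e. if Or e = 1 then 1 else (0::real)"])
qed

lemma psi_Ints:
  assumes "totally_unimodular A"
  shows "psi A Or $ i \<in> \<int>"
  unfolding psi_def using totally_unimodular_entry[OF assms]
  by (auto simp: column_def intro!: Ints_sum)

lemma mem_basis_cell_iff:
  fixes A :: "real ^ 'e::finite ^ 'r::finite"
  assumes Or: "\<And>e. e \<notin> B \<Longrightarrow> Or e = \<sigma> (fund_circuit A B e) $ e"
  shows "b \<in> basis_cell A \<sigma> B \<longleftrightarrow>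
    (\<exists>x. supp x \<subseteq> B \<and> (\<forall>e. 0 \<le> x $ e \<and> x $ e \<le> 1) \<and>
      b = A *v (x + indicator_vec ({e. Or e = 1} - B)))" (is "_ \<longleftrightarrow> ?R")
proof -
  have S: "{e. e \<notin> B \<and> \<sigma> (fund_circuit A B e) $ e = 1} = {e. Or e = 1} - B" using Or by auto
  have eq: "A *v (x + indicator_vec ({e. Or e = 1} - B)) =
      (\<Sum>e \<in> B. x $ e *\<^sub>R column e A) + (\<Sum>e \<in> {e. Or e = 1} - B. column e A)"
    if "supp x \<subseteq> B" for x
    by (simp add: matrix_vector_right_distrib matrix_mult_indicator matrix_mult_columns[OF that])
  show ?thesis
  proof
    assume "b \<in> basis_cell A \<sigma> B"
    then obtain c where c: "\<forall>e \<in> B. 0 \<le> c e \<and> c e \<le> 1"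
      "b = (\<Sum>e \<in> B. c e *\<^sub>R column e A) + (\<Sum>e \<in> {e. Or e = 1} - B. column e A)"
      unfolding basis_cell_def S by blast
    let ?x = "\<chi> e. if e \<in> B then c e else 0"
    have x: "supp ?x \<subseteq> B" by (auto simp: supp_def)
    have "b = A *v (?x + indicator_vec ({e. Or e = 1} - B))"
      unfolding eq[OF x] c(2) by simp
    moreover have "\<forall>e. 0 \<le> ?x $ e \<and> ?x $ e \<le> 1" using c(1) by simp
    ultimately show ?R using x by blast
  next
    assume ?R
    then obtain x where x: "supp x \<subseteq> B" "\<forall>e. 0 \<le> x $ e \<and> x $ e \<le> 1"
      "b = A *v (x + indicator_vec ({e. Or e = 1} - B))" by blast
    then show "b \<in> basis_cell A \<sigma> B"
      unfolding basis_cell_def S using eq[OF x(1)] by auto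
  qed
qed

text \<open>
  In the coordinates of the basis \<open>B\<close>, a lattice point of the shifted cell has integral
  coordinates \<open>c + \<epsilon> t\<close> with \<open>0 \<le> c \<le> 1\<close> and \<open>0 < \<bar>\<epsilon> t\<bar> < 1\<close>. Hence each is \<open>1\<close> or \<open>0\<close>
  according to the sign of \<open>t\<close>. The vector \<open>t\<close> is the basic solution of \<open>B\<close>, whose signs on \<open>B\<close>
  are those of the orientation.
\<close>
lemma shifted_cell_lattice_points:
  fixes A :: "real ^ 'e::finite ^ 'r::finite"
  assumes tu: "totally_unimodular A" and rank: "rank A = CARD('r)"
    and B: "base_in (kernel A) B" and w: "w \<in> row_space A"
    and t: "supp t \<subseteq> B" "A *v t = A *v w"
    and Or: "is_orientation Or" "\<And>e. e \<in> B \<Longrightarrow> 0 < Or e * t $ e"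
      "\<And>e. e \<notin> B \<Longrightarrow> Or e = \<sigma> (fund_circuit A B e) $ e"
    and eps: "0 < \<epsilon>" "\<And>e. \<epsilon> * \<bar>t $ e\<bar> < 1"
  shows "(\<lambda>v. v + \<epsilon> *\<^sub>R w) ` row_basis_cell A \<sigma> B \<inter> (lattice_points A \<inter> row_zonotope A) =
    {orientation_point A Or}" (is "?L = {?z}")
proof
  let ?N = "indicator_vec ({e. Or e = 1} - B)" and ?I = "indicator_vec {e. Or e = 1}"
  have cell: "b \<in> basis_cell A \<sigma> B \<longleftrightarrow>
      (\<exists>x. supp x \<subseteq> B \<and> (\<forall>e. 0 \<le> x $ e \<and> x $ e \<le> 1) \<and> b = A *v (x + ?N))" for b
    by (rule mem_basis_cell_iff) (rule Or(3))
  have Or1: "Or e = 1 \<or> Or e = -1" for e using Or(1) by (auto simp: is_orientation_def)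
  have split: "?I = indicator_vec ({e. Or e = 1} \<inter> B) + ?N"
    by (auto simp: indicator_vec_def vec_eq_iff)
  show "?L \<subseteq> {?z}"
  proof
    fix u assume u: "u \<in> ?L"
    then obtain v where v: "v \<in> row_space A" "A *v v \<in> basis_cell A \<sigma> B" "u = v + \<epsilon> *\<^sub>R w"
      by (auto simp: row_basis_cell_def)
    have u': "u \<in> row_space A" "\<And>i. (A *v u) $ i \<in> \<int>" using u by (auto simp: lattice_points_def)
    obtain x where x: "supp x \<subseteq> B" "\<And>e. 0 \<le> x $ e \<and> x $ e \<le> 1" "A *v v = A *v (x + ?N)"
      using v(2) unfolding cell by blast
    let ?y = "x + \<epsilon> *\<^sub>R t"
    have Au: "A *v u = A *v (?y + ?N)"
      using x(3) t(2) by (simp add: v(3) matrix_vector_right_distrib matrix_vector_mult_scaleR)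
    have y: "supp ?y \<subseteq> B"
    proof
      fix e assume "e \<in> supp ?y"
      then have "e \<in> supp x \<or> e \<in> supp t" by (auto simp: supp_def)
      then show "e \<in> B" using x(1) t(1) by blast
    qed
    have "(A *v ?y) $ i \<in> \<int>" for i
    proof -
      have "A *v ?y = A *v u - A *v ?N" by (simp add: Au matrix_vector_right_distrib)
      moreover have "(A *v ?N) $ i \<in> \<int>"
        using totally_unimodular_entry[OF tu]
        by (auto simp: matrix_mult_indicator column_def intro!: Ints_sum)
      ultimately show ?thesis using u'(2)[of i] by simp
    qed
    then have int: "?y $ e \<in> \<int>" for e by (rule integral_coordinates[OF tu rank B y])
    have "?y $ e = indicator_vec ({e. Or e = 1} \<inter> B) $ e" for e
    proof (cases "e \<in> B")
      case False
      then show ?thesis using y by (auto simp: supp_def indicator_vec_def)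
    next
      case True
      obtain n :: int where n: "?y $ e = n" using int[of e] by (auto elim: Ints_cases)
      have sign: "0 < Or e * t $ e" by (rule Or(2)[OF True])
      have abs: "\<bar>\<epsilon> * t $ e\<bar> < 1" using eps(2)[of e] eps(1) by (simp add: abs_mult)
      have xe: "0 \<le> x $ e" "x $ e \<le> 1" using x(2) by auto
      have n': "n = x $ e + \<epsilon> * t $ e" using n by simp
      show ?thesis
      proof (cases "Or e = 1")
        case True
        then have "0 < \<epsilon> * t $ e" using sign eps(1) by simp
        then have "0 < real_of_int n" "real_of_int n < 2" using n' xe abs by linarith+
        then have "n = 1" by linarith
        then show ?thesis using n True \<open>e \<in> B\<close> by (simp add: indicator_vec_def)
      next
        case False
        then have "\<epsilon> * t $ e < 0" using sign eps(1) Or1[of e] by (auto simp: mult_pos_neg)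
        then have "-1 < real_of_int n" "real_of_int n < 1" using n' xe abs by linarith+
        then have "n = 0" by linarith
        then show ?thesis using n False by (simp add: indicator_vec_def)
      qed
    qed
    then have "?y + ?N = ?I" unfolding split by (simp add: vec_eq_iff)
    then have "A *v u = A *v ?z"
      using Au by (simp only: matrix_mult_orientation_point psi_eq)
    then show "u \<in> {?z}"
      using matrix_vector_mul_injective_on_rowspace[of A u ?z] u'(1) orientation_point_row_space[of A Or]
      by (simp add: row_space_def)
  qed
  have "?z \<in> lattice_points A"
    by (simp add: lattice_points_def orientation_point_row_space matrix_mult_orientation_point
        psi_Ints[OF tu])
  moreover have "?z - \<epsilon> *\<^sub>R w \<in> row_basis_cell A \<sigma> B"
  proof -
    \<comment> \<open>The basis coordinates of the point that the shift moves to \<open>?z\<close>.\<close>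
    let ?x = "indicator_vec ({e. Or e = 1} \<inter> B) - \<epsilon> *\<^sub>R t"
    have "A *v (?z - \<epsilon> *\<^sub>R w) = A *v (?x + ?N)"
      unfolding matrix_vector_mult_diff_distrib matrix_mult_orientation_point psi_eq split
      using t(2)
      by (simp add: matrix_vector_mult_diff_distrib matrix_vector_right_distrib matrix_vector_mult_scaleR)
    moreover have "supp ?x \<subseteq> B"
      using t(1) by (fastforce simp: supp_def indicator_vec_def)
    moreover have "0 \<le> ?x $ e \<and> ?x $ e \<le> 1" for e
    proof (cases "e \<in> B")
      case False
      then have "t $ e = 0" using t(1) by (auto simp: supp_def)
      then show ?thesis using False by (simp add: indicator_vec_def)
    next
      case True
      have sign: "0 < Or e * t $ e" by (rule Or(2)[OF True])
      have abs: "\<bar>\<epsilon> * t $ e\<bar> < 1" using eps(2)[of e] eps(1) by (simp add: abs_mult)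
      show ?thesis
      proof (cases "Or e = 1")
        case one: True
        then have "0 < \<epsilon> * t $ e" using sign eps(1) by simp
        then show ?thesis using abs one True by (simp add: indicator_vec_def)
      next
        case False
        then have "\<epsilon> * t $ e < 0" using sign eps(1) Or1[of e] by (auto simp: mult_pos_neg)
        then show ?thesis using abs False by (simp add: indicator_vec_def)
      qed
    qed
    moreover have "?z - \<epsilon> *\<^sub>R w \<in> row_space A"
      using orientation_point_row_space w
      by (intro subspace_diff subspace_scale subspace_row_space)
    ultimately show ?thesis unfolding row_basis_cell_def using cell by blast
  qed
  ultimately show "{?z} \<subseteq> ?L"
    using orientation_point_row_zonotope by (auto intro!: image_eqI[of _ _ "?z - \<epsilon> *\<^sub>R w"])
qed

lemma is_shifted_point_iff:
  fixes A :: "real ^ 'e::finite ^ 'r::finite"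
  assumes tu: "totally_unimodular A" and rank: "rank A = CARD('r)"
    and B: "base_in (kernel A) B" and w: "w \<in> row_space A"
    and t: "supp t \<subseteq> B" "A *v t = A *v w"
    and Or: "is_orientation Or" "\<And>e. e \<in> B \<Longrightarrow> 0 < Or e * t $ e"
      "\<And>e. e \<notin> B \<Longrightarrow> Or e = \<sigma> (fund_circuit A B e) $ e"
  shows "is_shifted_point A \<sigma> w B z \<longleftrightarrow> z = orientation_point A Or"
proof -
  have "\<forall>\<^sub>F \<epsilon> in at_right 0. \<epsilon> * \<bar>t $ e\<bar> < 1" for e
  proof -
    have "((\<lambda>\<epsilon>. \<epsilon> * \<bar>t $ e\<bar>) \<longlongrightarrow> 0 * \<bar>t $ e\<bar>) (at_right 0)" by (intro tendsto_intros)
    then show ?thesis by (rule order_tendstoD) simp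
  qed
  then have "\<forall>\<^sub>F \<epsilon> in at_right 0. \<forall>e. \<epsilon> * \<bar>t $ e\<bar> < 1" by (rule eventually_all_finite)
  then have ev: "\<forall>\<^sub>F \<epsilon> in at_right 0.
      (\<lambda>v. v + \<epsilon> *\<^sub>R w) ` row_basis_cell A \<sigma> B \<inter> (lattice_points A \<inter> row_zonotope A) =
      {orientation_point A Or}"
    using eventually_at_right_less[of 0]
    by eventually_elim (intro shifted_cell_lattice_points[OF tu rank B w t Or]; simp)
  show ?thesis
  proof
    assume "is_shifted_point A \<sigma> w B z"
    from eventually_conj[OF this[unfolded is_shifted_point_def] ev]
    have "\<forall>\<^sub>F \<epsilon> in at_right (0::real). z = orientation_point A Or"
      by (rule eventually_mono) auto
    then show "z = orientation_point A Or" by simp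
  next
    assume "z = orientation_point A Or"
    then show "is_shifted_point A \<sigma> w B z" using ev by (simp add: is_shifted_point_def)
  qed
qed

text \<open>
  An orientation is twice the indicator vector of its positive set minus the all-ones vector,
  which cancels in the difference.
\<close>
lemma psi_eq_imp_diff_kernel:
  fixes A :: "real ^ 'e::finite ^ 'r::finite"
  assumes "is_orientation Or" "is_orientation Or'" and "psi A Or = psi A Or'"
  shows "(\<chi> e. Or e - Or' e) \<in> kernel A"
proof -
  have "Or e = 1 \<or> Or e = -1" "Or' e = 1 \<or> Or' e = -1" for e
    using assms(1,2) by (auto simp: is_orientation_def)
  then have "(\<chi> e. Or e - Or' e) =
      2 *\<^sub>R (indicator_vec {e. Or e = 1} - indicator_vec {e. Or' e = 1})"
    by (force simp: vec_eq_iff indicator_vec_def)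
  then show ?thesis
    using assms(3)
    by (simp add: kernel_def psi_eq matrix_vector_mult_scaleR matrix_vector_mult_diff_distrib)
qed

section \<open>Shifted points, compatible orientations and bases\<close>

theorem theorem1p3p3:
  fixes A :: "real ^ 'e ^ 'r"
    and \<sigma> \<sigma>' :: "'e set \<Rightarrow> real ^ 'e"
    and w :: "real ^ 'e"
  assumes "totally_unimodular A"
    and "rank A = CARD('r)"
    and "circuit_signature A \<sigma>" and "acyclic_on (circuits A) \<sigma>"
    and "cocircuit_signature A \<sigma>'" and "acyclic_on (cocircuits A) \<sigma>'"
    and "w \<in> row_space A"
    and "\<And>C. C \<in> cocircuits A \<Longrightarrow> w \<bullet> \<sigma>' C > 0"
  shows "(\<forall>B \<in> bases A.
            (\<exists>!z. is_shifted_point A \<sigma> w B z) \<and>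
            (\<exists>!Or. Or \<in> compatible_orientations A \<sigma> \<sigma>' \<and>
                   psi A Or = A *v shifted_point A \<sigma> w B)) \<and>
         (\<forall>B \<in> bases A. phi A \<sigma> \<sigma>' w B = beta_hat A \<sigma> \<sigma>' B) \<and>
         bij_betw (beta_hat A \<sigma> \<sigma>') (bases A) (compatible_orientations A \<sigma> \<sigma>')"
proof -
  have sig: "\<sigma> C \<in> kernel A" "\<sigma> C $ e \<in> {-1, 0, 1}" "supp (\<sigma> C) = C"
    if "C \<in> circuits A" for C e
    using assms(3) that by (auto simp: circuit_signature_def signed_circuits_def kernel_def)
  have sig': "\<sigma>' C \<in> row_space A" "\<sigma>' C $ e \<in> {-1, 0, 1}" "supp (\<sigma>' C) = C"
    if "C \<in> cocircuits A" for C e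
    using assms(5) that by (auto simp: cocircuit_signature_def signed_cocircuits_def)
  have "inj_on \<sigma> (circuits A)" using sig(3) by (metis inj_onI)
  then obtain p where p: "\<And>C. C \<in> circuits A \<Longrightarrow> 0 < p \<bullet> \<sigma> C"
    using acyclic_on_positive assms(4) by blast
  interpret dual_signatures "kernel A" \<sigma> p \<sigma>' w
    unfolding dual_signatures_def positive_signature_def orthogonal_comp_kernel
      circuits_eq[symmetric] cocircuits_eq[symmetric]
    using subspace_kernel subspace_row_space sig sig' p assms(8) by blast
  let ?X = "compatible_orientations A \<sigma> \<sigma>'" and ?b = "beta_hat A \<sigma> \<sigma>'"
  have bij: "bij_betw ?b (bases A) ?X"
    using orient_bij by (simp add: beta_hat_eq bases_eq compatible_orientations_eq)
  have mem: "?b B \<in> ?X" if "B \<in> bases A" for B using bij that by (rule bij_betwE[rule_format])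
  have point: "is_shifted_point A \<sigma> w B z \<longleftrightarrow> z = orientation_point A (?b B)"
    if "B \<in> bases A" for B z
  proof -
    have B: "base_in (kernel A) B" using that by (simp add: bases_eq)
    \<comment> \<open>On \<open>B\<close>, the basic solution lists the coordinates of \<open>A w\<close> in the basis.\<close>
    obtain t where t: "t - w \<in> kernel A" "supp t \<subseteq> B" using basic_solution_exists[OF B] .
    show ?thesis
    proof (rule is_shifted_point_iff[OF assms(1,2) B assms(7) t(2)])
      show "A *v t = A *v w"
        using t(1) by (simp add: kernel_def matrix_vector_mult_diff_distrib)
      show "is_orientation (?b B)" using mem[OF that] by (simp add: compatible_orientations_def)
      show "0 < ?b B e * t $ e" if "e \<in> B" for e
        using basic_solution_sign[OF B t that] by (simp add: beta_hat_eq)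
    qed (simp add: beta_hat_def)
  qed
  have shifted: "A *v shifted_point A \<sigma> w B = psi A (?b B)" if "B \<in> bases A" for B
    by (simp add: shifted_point_def point[OF that] matrix_mult_orientation_point)
  have unique: "Or = ?b B" if "B \<in> bases A" "Or \<in> ?X" "psi A Or = psi A (?b B)" for B Or
    using mem[OF that(1)] that(2) psi_eq_imp_diff_kernel[OF _ _ that(3)]
    by (intro prim.signature_compatible_determined_mod_subspace)
      (auto simp: compatible_orientations_eq compatible_in_def)
  have "\<exists>!Or. Or \<in> ?X \<and> psi A Or = A *v shifted_point A \<sigma> w B" if "B \<in> bases A" for B
    unfolding shifted[OF that] using mem[OF that] unique[OF that] by blast
  moreover have "phi A \<sigma> \<sigma>' w B = ?b B" if "B \<in> bases A" for B
    unfolding phi_def shifted[OF that]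
    using mem[OF that] unique[OF that] by (intro the_equality) auto
  moreover have "\<exists>!z. is_shifted_point A \<sigma> w B z" if "B \<in> bases A" for B
    using point[OF that] by simp
  ultimately show ?thesis using bij by simp
qed

end
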